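(* Let $T$ be a nonempty subset of the positive integers. Then: (1) $\displaystyle H[F^T]=\prod_{n\in T} (1-p_n)^{-1}$. (2) $\displaystyle F^T=p^T[Lie]=\sum_{m\in T} Lie[p_m]$, or equivalently, for every $n\ge1$, $\displaystyle f_n^T=\sum_{m\in T,\ m|n} Lie_{n/m}[p_m]$. (3) If $\displaystyle G^T=\sum_{k\geq 0}\sum_{m\in T} Lie[p_{m\cdot 2^k}]$, then $\displaystyle E[G^T]=\prod_{n\in T} (1-p_n)^{-1}=H[F^T]$.
   Context: $h_n,e_n,p_n$ are the complete homogeneous, elementary and power-sum symmetric functions (with formal infinite sums allowed), $f[g]$ is plethysm, $H=\sum_{r\ge0}h_r$, $E=\sum_{r\ge0}e_r$, $\mu$ is the number-theoretic Möbius function. $Lie_n=\frac1n\sum_{d|n}\mu(d)p_d^{n/d}$ and $Lie=\sum_{n\ge1}Lie_n$. For a nonempty set $T$ of positive integers: $\psi^T(d)=\sum_{m|d,\ m\in T} m\,\mu(d/m)$ for $d\ge1$; $f_n^T=\frac1n\sum_{d|n}\psi^T(d)\,p_d^{n/d}$; $F^T=\sum_{n\ge1}f_n^T$; $p^T=\sum_{n\in T}p_n$. *)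

theory Defs
  imports
    "HOL-Analysis.Infinite_Sum"
    "HOL-Library.Multiset"
    "HOL-Computational_Algebra.Squarefree"
begin

section \<open>Formal power series in countably many variables\<close>

text \<open>
  Formal power series over the rationals in the variables \<open>x\<^sub>0, x\<^sub>1, x\<^sub>2, \<dots>\<close>. A monomial is the
  multiset of the indices of its factors: \<open>{#0, 0, 3#}\<close> stands for \<open>x\<^sub>0\<^sup>2 x\<^sub>3\<close>. So \<open>+\<close> multiplies
  monomials, \<open>size\<close> is the degree, and \<open>repeat_mset n m\<close> is the \<open>n\<close>-th power of \<open>m\<close>.
  Symmetric functions, formal infinite sums allowed, live in this ring.
\<close>

typedef series = "UNIV :: (nat multiset \<Rightarrow> rat) set"
  morphisms coeff Series ..

lemma coeff_Series [simp]: "coeff (Series c) m = c m"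
  by (simp add: Series_inverse)

lemma series_eqI: "(\<And>m. coeff f m = coeff g m) \<Longrightarrow> f = g"
  by (metis coeff_inject ext)

lemma finite_submultisets: "finite {a. a \<subseteq># (m :: 'a multiset)}"
proof (induction m)
  case empty
  then show ?case by simp
next
  case (add x m)
  have "{a. a \<subseteq># add_mset x m} \<subseteq> {a. a \<subseteq># m} \<union> add_mset x ` {a. a \<subseteq># m}"
  proof
    fix a assume a: "a \<in> {a. a \<subseteq># add_mset x m}"
    show "a \<in> {a. a \<subseteq># m} \<union> add_mset x ` {a. a \<subseteq># m}"
    proof (cases "x \<in># a")
      case True
      then obtain b where "a = add_mset x b" by (metis insert_DiffM)
      then show ?thesis using a by auto
    next
      case False
      then have "a \<subseteq># m" using a
        by (metis add_mset_remove_trivial diff_single_trivial mem_Collect_eq subset_eq_diff_conv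
            union_mset_add_mset_right add.right_neutral)
      then show ?thesis by simp
    qed
  qed
  then show ?case using add.IH finite_subset by blast
qed

instantiation series :: comm_ring_1
begin

definition "0 = Series (\<lambda>_. 0)"
definition "1 = Series (\<lambda>m. if m = {#} then 1 else 0)"
definition "f + g = Series (\<lambda>m. coeff f m + coeff g m)"
definition "f - g = Series (\<lambda>m. coeff f m - coeff g m)"
definition "- f = Series (\<lambda>m. - coeff f m)"
definition "f * g = Series (\<lambda>m. \<Sum>a | a \<subseteq># m. coeff f a * coeff g (m - a))"

instance
proof
  fix f g h :: series
  show "f * g * h = f * (g * h)"
  proof (rule series_eqI)
    fix m
    have "coeff (f * g * h) m =
        (\<Sum>(a, b) \<in> Sigma {a. a \<subseteq># m} (\<lambda>a. {b. b \<subseteq># a}).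
          coeff f b * coeff g (a - b) * coeff h (m - a))"
      by (simp add: times_series_def sum_distrib_right sum.Sigma finite_submultisets)
    also have "\<dots> = (\<Sum>(b, c) \<in> Sigma {b. b \<subseteq># m} (\<lambda>b. {c. c \<subseteq># m - b}).
          coeff f b * (coeff g c * coeff h (m - b - c)))"
      by (rule sum.reindex_bij_witness[where i = "\<lambda>(b, c). (b + c, b)" and j = "\<lambda>(a, b). (b, a - b)"])
         (auto simp: mult.assoc subseteq_mset_def le_diff_conv2 intro: order_trans,
           metis diff_le_mono, metis add.commute)
    also have "\<dots> = coeff (f * (g * h)) m"
      by (simp add: times_series_def sum_distrib_left sum.Sigma finite_submultisets)
    finally show "coeff (f * g * h) m = coeff (f * (g * h)) m" .
  qed
  show "f * g = g * f"
  proof (rule series_eqI)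
    fix m
    have "(\<Sum>a | a \<subseteq># m. coeff f a * coeff g (m - a)) = (\<Sum>a | a \<subseteq># m. coeff g a * coeff f (m - a))"
      by (rule sum.reindex_bij_witness[where i = "\<lambda>a. m - a" and j = "\<lambda>a. m - a"])
         (auto simp: mult.commute subset_mset.diff_diff_right)
    then show "coeff (f * g) m = coeff (g * f) m"
      by (simp add: times_series_def)
  qed
  show "1 * f = f"
  proof (rule series_eqI)
    fix m
    have "coeff (1 * f) m = (\<Sum>a | a \<subseteq># m. if a = {#} then coeff f m else 0)"
      by (auto simp: times_series_def one_series_def intro!: sum.cong)
    also have "\<dots> = coeff f m"
      by (subst sum.delta) (auto simp: finite_submultisets)
    finally show "coeff (1 * f) m = coeff f m" .
  qed
  have "coeff (0 :: series) {#} \<noteq> coeff 1 {#}"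
    by (simp add: zero_series_def one_series_def)
  then show "(0 :: series) \<noteq> 1"
    by auto
qed (auto simp: plus_series_def minus_series_def uminus_series_def times_series_def
      zero_series_def algebra_simps sum.distrib intro!: series_eqI)

end

text \<open>The junk value of \<open>inverse\<close> on non-units is \<open>0\<close>.\<close>

instantiation series :: inverse
begin

definition "inverse (f :: series) =
  (if \<exists>g. f * g = 1 then THE g. f * g = 1 else 0)"
definition "f div (g :: series) = f * inverse g"

instance ..

end

lemma inverse_series_eqI:
  assumes "f * g = (1 :: series)"
  shows "inverse f = g"
proof -
  have "g' = g" if "f * g' = 1" for g'
    using assms that by (metis mult.commute mult.assoc mult_1)
  with assms show ?thesis
    unfolding inverse_series_def by (metis (mono_tags, lifting) the_equality)
qed

text \<open>
  The topology in which a net of series converges iff each coefficient is eventually constant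
  (lemma \<open>tendsto_series_iff\<close>). With it, \<open>has_sum\<close> and \<open>infsum\<close> are the formal infinite sums.
\<close>

instantiation series :: t2_space
begin

definition "open (U :: series set) \<longleftrightarrow>
  (\<forall>f\<in>U. \<exists>M. finite M \<and> (\<forall>g. (\<forall>m\<in>M. coeff g m = coeff f m) \<longrightarrow> g \<in> U))"

instance
proof
  show "open (UNIV :: series set)"
    by (auto simp: open_series_def)
next
  fix U V :: "series set"
  assume UV: "open U" "open V"
  show "open (U \<inter> V)"
    unfolding open_series_def
  proof
    fix f assume "f \<in> U \<inter> V"
    then obtain M N where "finite M" "\<forall>g. (\<forall>m\<in>M. coeff g m = coeff f m) \<longrightarrow> g \<in> U"
      "finite N" "\<forall>g. (\<forall>m\<in>N. coeff g m = coeff f m) \<longrightarrow> g \<in> V"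
      using UV unfolding open_series_def by (metis IntD1 IntD2)
    then show "\<exists>M. finite M \<and> (\<forall>g. (\<forall>m\<in>M. coeff g m = coeff f m) \<longrightarrow> g \<in> U \<inter> V)"
      by (intro exI[of _ "M \<union> N"]) auto
  qed
next
  fix K :: "series set set"
  assume K: "\<forall>U\<in>K. open U"
  show "open (\<Union>K)"
    unfolding open_series_def
  proof
    fix f assume "f \<in> \<Union>K"
    then obtain U where U: "U \<in> K" "f \<in> U" by blast
    then obtain M where "finite M" "\<forall>g. (\<forall>m\<in>M. coeff g m = coeff f m) \<longrightarrow> g \<in> U"
      using K unfolding open_series_def by metis
    with U show "\<exists>M. finite M \<and> (\<forall>g. (\<forall>m\<in>M. coeff g m = coeff f m) \<longrightarrow> g \<in> \<Union>K)"
      by blast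
  qed
next
  fix f g :: series
  assume "f \<noteq> g"
  then obtain m where m: "coeff f m \<noteq> coeff g m"
    using series_eqI by blast
  have op: "open {k. coeff k m = c}" for c
    by (auto simp: open_series_def intro!: exI[of _ "{m}"])
  show "\<exists>U V. open U \<and> open V \<and> f \<in> U \<and> g \<in> V \<and> U \<inter> V = {}"
    using m by (intro exI[of _ "{k. coeff k m = coeff f m}"] exI[of _ "{k. coeff k m = coeff g m}"])
      (auto simp: op)
qed

end

lemma tendsto_series_iff:
  "(F \<longlongrightarrow> (l :: series)) net \<longleftrightarrow> (\<forall>m. \<forall>\<^sub>F i in net. coeff (F i) m = coeff l m)"
proof
  assume F: "(F \<longlongrightarrow> l) net"
  show "\<forall>m. \<forall>\<^sub>F i in net. coeff (F i) m = coeff l m"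
  proof
    fix m
    have "open {k. coeff k m = coeff l m}"
      by (auto simp: open_series_def intro!: exI[of _ "{m}"])
    from topological_tendstoD[OF F this] show "\<forall>\<^sub>F i in net. coeff (F i) m = coeff l m"
      by simp
  qed
next
  assume F: "\<forall>m. \<forall>\<^sub>F i in net. coeff (F i) m = coeff l m"
  show "(F \<longlongrightarrow> l) net"
  proof (rule topological_tendstoI)
    fix U :: "series set" assume "open U" "l \<in> U"
    then obtain M where M: "finite M" "\<And>g. (\<forall>m\<in>M. coeff g m = coeff l m) \<Longrightarrow> g \<in> U"
      unfolding open_series_def by metis
    have "\<forall>\<^sub>F i in net. \<forall>m\<in>M. coeff (F i) m = coeff l m"
      using F M(1) by (simp add: eventually_ball_finite)
    then show "\<forall>\<^sub>F i in net. F i \<in> U"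
      by eventually_elim (rule M(2))
  qed
qed

instance series :: topological_comm_monoid_add
proof
  fix f g :: series
  have *: "\<forall>\<^sub>F k in nhds l. coeff k m = coeff l m" for l m
    using tendsto_series_iff[of "\<lambda>k. k" l "nhds l"] by (simp add: filterlim_ident)
  show "((\<lambda>k. fst k + snd k) \<longlongrightarrow> f + g) (nhds f \<times>\<^sub>F nhds g)"
    unfolding tendsto_series_iff
  proof
    fix m
    show "\<forall>\<^sub>F k in nhds f \<times>\<^sub>F nhds g. coeff (fst k + snd k) m = coeff (f + g) m"
      using eventually_prodI[OF *[of m f] *[of m g]]
      by eventually_elim (simp add: plus_series_def)
  qed
qed

definition const :: "rat \<Rightarrow> series" where
  "const c = Series (\<lambda>m. if m = {#} then c else 0)"

definition has_infprod :: "('a \<Rightarrow> series) \<Rightarrow> 'a set \<Rightarrow> series \<Rightarrow> bool" where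
  "has_infprod f A x \<longleftrightarrow> (prod f \<longlongrightarrow> x) (finite_subsets_at_top A)"


section \<open>Symmetric functions and plethysm\<close>

definition h_sym :: "nat \<Rightarrow> series" where
  "h_sym n = Series (\<lambda>m. if size m = n then 1 else 0)"

definition e_sym :: "nat \<Rightarrow> series" where
  "e_sym n = Series (\<lambda>m. if size m = n \<and> (\<forall>i. count m i \<le> 1) then 1 else 0)"

definition p_sym :: "nat \<Rightarrow> series" where
  "p_sym n = Series (\<lambda>m. if \<exists>i. m = replicate_mset n i then 1 else 0)"

definition H :: series where
  "H = (\<Sum>\<^sub>\<infinity>r. h_sym r)"

definition E :: series where
  "E = (\<Sum>\<^sub>\<infinity>r. e_sym r)"

text \<open>\<open>p_plethysm n g\<close> is \<open>p\<^sub>n[g] = g(x\<^sub>0\<^sup>n, x\<^sub>1\<^sup>n, \<dots>)\<close> for \<open>n > 0\<close>; the sum has at most one term.\<close>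

definition p_plethysm :: "nat \<Rightarrow> series \<Rightarrow> series" where
  "p_plethysm n g = Series (\<lambda>m. \<Sum>m' | repeat_mset n m' = m. coeff g m')"

definition partitions :: "nat multiset set" where
  "partitions = {l. 0 \<notin># l}"

text \<open>
  Plethysm \<open>f[g]\<close>: expand the symmetric function \<open>f\<close> as \<open>\<Sum>\<^sub>\<lambda> c\<^sub>\<lambda> p\<^sub>\<lambda>\<close> with
  \<open>p\<^sub>\<lambda> = \<Prod>\<^sub>i p\<^bsub>\<lambda>\<^sub>i\<^esub>\<close>, and replace each \<open>p\<^sub>k\<close> by \<open>p\<^sub>k[g]\<close>. So \<open>f \<mapsto> f[g]\<close> is linear, multiplicative
  and compatible with formal infinite sums, and rational constants are fixed. The coefficients
  \<open>c\<^sub>\<lambda>\<close> are unique, as there are infinitely many variables. The value is unspecified if \<open>f\<close> has no such expansion or if the resulting sum does not converge; the latter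
  cannot happen when \<open>g\<close> has zero constant term.
\<close>

definition plethysm :: "series \<Rightarrow> series \<Rightarrow> series"  (\<open>_\<lbrakk>_\<rbrakk>\<close> [1000, 0] 1000) where
  "f\<lbrakk>g\<rbrakk> = (THE r. \<exists>c :: nat multiset \<Rightarrow> rat.
     ((\<lambda>l. const (c l) * (\<Prod>k\<in>#l. p_sym k)) has_sum f) partitions \<and>
     ((\<lambda>l. const (c l) * (\<Prod>k\<in>#l. p_plethysm k g)) has_sum r) partitions)"


section \<open>The series attached to a set of positive integers\<close>

definition mobius :: "nat \<Rightarrow> int" where
  "mobius n = (if squarefree n then (- 1) ^ card (prime_factors n) else 0)"

definition Lie_n :: "nat \<Rightarrow> series" where
  "Lie_n n = const (1 / of_nat n) * (\<Sum>d | d dvd n. of_int (mobius d) * p_sym d ^ (n div d))"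

definition Lie :: series where
  "Lie = (\<Sum>\<^sub>\<infinity>n\<in>{1..}. Lie_n n)"

definition psi :: "nat set \<Rightarrow> nat \<Rightarrow> int" where
  "psi T d = (\<Sum>m | m dvd d \<and> m \<in> T. int m * mobius (d div m))"

definition f_n :: "nat set \<Rightarrow> nat \<Rightarrow> series" where
  "f_n T n = const (1 / of_nat n) * (\<Sum>d | d dvd n. of_int (psi T d) * p_sym d ^ (n div d))"

definition F :: "nat set \<Rightarrow> series" where
  "F T = (\<Sum>\<^sub>\<infinity>n\<in>{1..}. f_n T n)"

definition p_set :: "nat set \<Rightarrow> series" where
  "p_set T = (\<Sum>\<^sub>\<infinity>n\<in>T. p_sym n)"

definition G :: "nat set \<Rightarrow> series" where
  "G T = (\<Sum>\<^sub>\<infinity>k. \<Sum>\<^sub>\<infinity>m\<in>T. Lie\<lbrakk>p_sym (m * 2 ^ k)\<rbrakk>)"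

end

theory Submission
  imports Defs
begin

text \<open>
  No logarithms or exponentials are used. Let \<open>D\<close> (below: \<open>euler\<close>) be the Euler derivation, which
  multiplies a series of degree \<open>n\<close> by \<open>n\<close>. From the power sum expansions,
  \<open>D(H[g]) = H[g] \<Sum>\<^sub>k p\<^sub>k[D g]\<close> and \<open>D(E[g]) = E[g] \<Sum>\<^sub>k (-1)\<^bsup>k-1\<^esup> p\<^sub>k[D g]\<close>, and the solution of such an
  equation is determined by its constant term. So it suffices to compute logarithmic derivatives.
  Moebius inversion gives \<open>\<Sum>\<^sub>k p\<^sub>k[D Lie] = p\<^sub>1 / (1 - p\<^sub>1)\<close>, so with
  \<open>F = \<Sum>\<^bsub>m\<in>T\<^esub> p\<^sub>m[Lie]\<close> we get
  \<open>\<Sum>\<^sub>k p\<^sub>k[D F] = \<Sum>\<^bsub>m\<in>T\<^esub> m p\<^sub>m / (1 - p\<^sub>m)\<close>, which is the logarithmic derivative of the product.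
  For \<open>E\<close>, \<open>\<Sum>\<^sub>k (-1)\<^bsup>k-1\<^esup> p\<^sub>k[h] = S - 2 p\<^sub>2[S]\<close> with \<open>S = \<Sum>\<^sub>k p\<^sub>k[h]\<close>, and \<open>G = F + p\<^sub>2[G]\<close> makes this
  expression for \<open>h = D G\<close> collapse to \<open>\<Sum>\<^sub>k p\<^sub>k[D F]\<close>.
\<close>

subsection \<open>Coefficients and formal infinite sums\<close>

lemma coeff_0 [simp]: "coeff 0 m = 0"
  and coeff_1: "coeff 1 m = (if m = {#} then 1 else 0)"
  and coeff_add [simp]: "coeff (f + g) m = coeff f m + coeff g m"
  and coeff_diff [simp]: "coeff (f - g) m = coeff f m - coeff g m"
  and coeff_uminus [simp]: "coeff (- f) m = - coeff f m"
  and coeff_mult: "coeff (f * g) m = (\<Sum>a | a \<subseteq># m. coeff f a * coeff g (m - a))"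
  by (simp_all add: zero_series_def one_series_def plus_series_def minus_series_def
      uminus_series_def times_series_def)

lemma coeff_sum: "coeff (sum f A) m = (\<Sum>x\<in>A. coeff (f x) m)"
  by (induction A rule: infinite_finite_induct) auto

lemma coeff_const_mult [simp]: "coeff (const c * f) m = c * coeff f m"
proof -
  have "coeff (const c * f) m = (\<Sum>a | a \<subseteq># m. if a = {#} then c * coeff f m else 0)"
    by (auto simp: coeff_mult const_def intro!: sum.cong)
  also have "\<dots> = c * coeff f m"
    by (subst sum.delta) (auto simp: finite_submultisets)
  finally show ?thesis .
qed

lemma const_mult: "const (a * b) = const a * const b"
  by (rule series_eqI, subst coeff_const_mult) (simp add: const_def)

lemma const_0 [simp]: "const 0 = 0" and const_1 [simp]: "const 1 = 1"
  by (auto intro!: series_eqI simp: const_def coeff_1)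

lemma const_minus: "const (- a) = - const a"
  by (auto intro!: series_eqI simp: const_def)

lemma const_add: "const (a + b) = const a + const b"
  by (auto intro!: series_eqI simp: const_def)

lemma of_nat_series: "of_nat n = const (of_nat n)"
  by (induction n) (auto simp: const_add)

lemma of_int_series: "of_int n = const (of_int n)"
  by (cases n rule: int_cases2) (auto simp: of_nat_series const_minus)

text \<open>The topology is discrete in each coefficient. If the partial sums at \<open>m\<close>
  are constant beyond a finite set \<open>X\<close>, adjoining a single further index to
  \<open>X\<close> shows that its term has coefficient 0 there.\<close>

lemma has_sum_series_iff:
  "(f has_sum s) A \<longleftrightarrow> (\<forall>m. \<exists>B. finite B \<and> B \<subseteq> A \<and> (\<forall>x\<in>A - B. coeff (f x) m = 0) \<and>
     (\<Sum>x\<in>B. coeff (f x) m) = coeff s m)"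
  unfolding has_sum_def tendsto_series_iff eventually_finite_subsets_at_top coeff_sum
proof (rule all_cong1, rule iffI)
  fix m
  assume "\<exists>X. finite X \<and> X \<subseteq> A \<and> (\<forall>Y. finite Y \<and> X \<subseteq> Y \<and> Y \<subseteq> A \<longrightarrow> (\<Sum>x\<in>Y. coeff (f x) m) = coeff s m)"
  then obtain X where X: "finite X" "X \<subseteq> A"
    "\<forall>Y. finite Y \<and> X \<subseteq> Y \<and> Y \<subseteq> A \<longrightarrow> (\<Sum>x\<in>Y. coeff (f x) m) = coeff s m"
    by (elim exE conjE)
  have "coeff (f x) m = 0" if "x \<in> A - X" for x
    using X(3)[rule_format, of X] X(3)[rule_format, of "insert x X"] X(1,2) that by auto
  then show "\<exists>B. finite B \<and> B \<subseteq> A \<and> (\<forall>x\<in>A - B. coeff (f x) m = 0) \<and>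
     (\<Sum>x\<in>B. coeff (f x) m) = coeff s m"
    using X(1,2) X(3)[rule_format, of X] by (intro exI[of _ X]) simp
next
  fix m
  assume "\<exists>B. finite B \<and> B \<subseteq> A \<and> (\<forall>x\<in>A - B. coeff (f x) m = 0) \<and>
     (\<Sum>x\<in>B. coeff (f x) m) = coeff s m"
  then obtain B where B: "finite B" "B \<subseteq> A" "\<forall>x\<in>A - B. coeff (f x) m = 0"
     "(\<Sum>x\<in>B. coeff (f x) m) = coeff s m" by blast
  have "(\<Sum>x\<in>Y. coeff (f x) m) = coeff s m" if "finite Y" "B \<subseteq> Y" "Y \<subseteq> A" for Y
    using B that by (subst sum.mono_neutral_right[of Y B]) auto
  then show "\<exists>X. finite X \<and> X \<subseteq> A \<and> (\<forall>Y. finite Y \<and> X \<subseteq> Y \<and> Y \<subseteq> A \<longrightarrow> (\<Sum>x\<in>Y. coeff (f x) m) = coeff s m)"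
    using B(1,2) by (intro exI[of _ B]) simp
qed

lemma has_sum_series_coeff:
  assumes "(f has_sum s) A" "finite C" "\<And>x. x \<in> A \<Longrightarrow> coeff (f x) m \<noteq> 0 \<Longrightarrow> x \<in> C" "C \<subseteq> A"
  shows "coeff s m = (\<Sum>x\<in>C. coeff (f x) m)"
proof -
  obtain B where B: "finite B" "B \<subseteq> A" "\<forall>x\<in>A - B. coeff (f x) m = 0"
     "(\<Sum>x\<in>B. coeff (f x) m) = coeff s m"
    using assms(1) unfolding has_sum_series_iff by blast
  have "(\<Sum>x\<in>B. coeff (f x) m) = (\<Sum>x\<in>C. coeff (f x) m)"
    using B assms by (intro sum.mono_neutral_cong) auto
  then show ?thesis using B by simp
qed

lemma has_sum_seriesI:
  assumes "\<And>m. finite (C m)" "\<And>m. C m \<subseteq> A"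
    and "\<And>m x. x \<in> A \<Longrightarrow> coeff (f x) m \<noteq> 0 \<Longrightarrow> x \<in> C m"
    and "\<And>m. coeff s m = (\<Sum>x\<in>C m. coeff (f x) m)"
  shows "(f has_sum s) A"
  unfolding has_sum_series_iff
proof
  fix m
  show "\<exists>B. finite B \<and> B \<subseteq> A \<and> (\<forall>x\<in>A - B. coeff (f x) m = 0) \<and>
     (\<Sum>x\<in>B. coeff (f x) m) = coeff s m"
    using assms(1)[of m] assms(2)[of m] assms(3)[of _ m] assms(4)[of m, symmetric]
    by (intro exI[of _ "C m"] conjI ballI) blast+
qed

text \<open>Fubini for formal sums, given the inner sums. At a fixed monomial only finitely many
  pairs contribute, and their first components form the finite set that the outer sum needs.\<close>

lemma has_sum_series_Sigma:
  fixes f :: "'a \<times> 'b \<Rightarrow> series"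
  assumes f: "(f has_sum s) (Sigma A B)" and g: "\<And>x. x \<in> A \<Longrightarrow> ((\<lambda>y. f (x, y)) has_sum g x) (B x)"
  shows "(g has_sum s) A"
  unfolding has_sum_series_iff
proof
  fix m
  obtain C where C: "finite C" "C \<subseteq> Sigma A B" "\<forall>z\<in>Sigma A B - C. coeff (f z) m = 0"
     "(\<Sum>z\<in>C. coeff (f z) m) = coeff s m"
    using f[unfolded has_sum_series_iff, rule_format, of m] by (elim exE conjE)
  have g': "coeff (g x) m = (\<Sum>y\<in>C `` {x}. coeff (f (x, y)) m)" if "x \<in> A" for x
  proof (rule has_sum_series_coeff[OF g[OF that]])
    show "finite (C `` {x})"
      by (rule finite_Image) (rule C(1))
    show "y \<in> C `` {x}" if "y \<in> B x" "coeff (f (x, y)) m \<noteq> 0" for y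
      using C(3) that \<open>x \<in> A\<close> by blast
    show "C `` {x} \<subseteq> B x"
      using C(2) by blast
  qed
  have "Sigma (fst ` C) (\<lambda>x. C `` {x}) = C" by force
  then have "coeff s m = (\<Sum>z\<in>Sigma (fst ` C) (\<lambda>x. C `` {x}). coeff (f z) m)"
    by (simp only: C(4))
  also have "\<dots> = (\<Sum>x\<in>fst ` C. \<Sum>y\<in>C `` {x}. coeff (f (x, y)) m)"
    by (subst sum.Sigma) (simp_all add: C(1))
  also have "\<dots> = (\<Sum>x\<in>fst ` C. coeff (g x) m)"
    by (rule sum.cong) (use C(2) in \<open>auto simp: g'\<close>)
  finally have 1: "(\<Sum>x\<in>fst ` C. coeff (g x) m) = coeff s m" ..
  have 2: "coeff (g x) m = 0" if "x \<in> A - fst ` C" for x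
  proof -
    have "C `` {x} = {}" using that by force
    then show ?thesis using that by (simp add: g')
  qed
  have "fst ` C \<subseteq> A" using C(2) by auto
  then show "\<exists>B. finite B \<and> B \<subseteq> A \<and> (\<forall>x\<in>A - B. coeff (g x) m = 0) \<and> (\<Sum>x\<in>B. coeff (g x) m) = coeff s m"
    using C(1) 1 2 by (intro exI[of _ "fst ` C"]) simp
qed

text \<open>Additive maps that are continuous for the coefficientwise topology. The finite set
  \<open>M\<close> depends only on the target monomial, and this lets such maps pass through formal
  infinite sums.\<close>

definition local_map :: "(series \<Rightarrow> series) \<Rightarrow> bool" where
  "local_map L \<longleftrightarrow> (\<forall>f g. L (f + g) = L f + L g) \<and>
     (\<forall>m. \<exists>M. finite M \<and> (\<forall>f g. (\<forall>k\<in>M. coeff f k = coeff g k) \<longrightarrow> coeff (L f) m = coeff (L g) m))"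

lemma local_map_has_sum:
  assumes L: "local_map L" and f: "(f has_sum s) A"
  shows "((\<lambda>x. L (f x)) has_sum L s) A"
proof -
  have add: "L (g + h) = L g + L h" for g h using L unfolding local_map_def by blast
  have "L 0 = 0" using add[of 0 0] by simp
  then have sum: "sum (\<lambda>x. L (f x)) X = L (sum f X)" for X
    by (induction X rule: infinite_finite_induct) (auto simp: add)
  show ?thesis
    unfolding has_sum_def tendsto_series_iff
  proof
    fix m
    obtain M where M: "finite M" "\<And>f g. (\<forall>k\<in>M. coeff f k = coeff g k) \<Longrightarrow> coeff (L f) m = coeff (L g) m"
      using L unfolding local_map_def by metis
    have "\<forall>\<^sub>F X in finite_subsets_at_top A. \<forall>k\<in>M. coeff (sum f X) k = coeff s k"
      using f M(1) by (simp add: eventually_ball_finite has_sum_def tendsto_series_iff)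
    then show "\<forall>\<^sub>F X in finite_subsets_at_top A. coeff (\<Sum>x\<in>X. L (f x)) m = coeff (L s) m"
      by eventually_elim (simp add: sum M(2))
  qed
qed

lemma local_map_mult: "local_map (\<lambda>f. g * f)"
  unfolding local_map_def
proof (intro conjI allI)
  fix m
  show "\<exists>M. finite M \<and> (\<forall>f h. (\<forall>k\<in>M. coeff f k = coeff h k) \<longrightarrow> coeff (g * f) m = coeff (g * h) m)"
    by (intro exI[of _ "{a. a \<subseteq># m}"]) (auto simp: finite_submultisets coeff_mult intro!: sum.cong)
qed (simp add: algebra_simps)

lemmas has_sum_series_cmult = local_map_has_sum[OF local_map_mult]

subsection \<open>Order and Euler derivation\<close>

text \<open>A lower bound for the order instead of the order itself, so that the zero series needs
  no special treatment.\<close>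

definition order_ge :: "nat \<Rightarrow> series \<Rightarrow> bool" where
  "order_ge n f \<longleftrightarrow> (\<forall>m. coeff f m \<noteq> 0 \<longrightarrow> n \<le> size m)"

lemma order_geD: "order_ge n f \<Longrightarrow> coeff f m \<noteq> 0 \<Longrightarrow> n \<le> size m"
  by (simp add: order_ge_def)

lemma order_ge_0 [simp]: "order_ge 0 f" and order_ge_zero [simp]: "order_ge n 0"
  by (auto simp: order_ge_def)

lemma order_ge_mono: "order_ge n f \<Longrightarrow> k \<le> n \<Longrightarrow> order_ge k f"
  by (auto simp: order_ge_def intro: le_trans)

lemma order_ge_mult:
  assumes "order_ge a f" "order_ge b g" shows "order_ge (a + b) (f * g)"
  unfolding order_ge_def
proof (intro allI impI)
  fix m assume "coeff (f * g) m \<noteq> 0"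
  then obtain k where k: "k \<subseteq># m" "coeff f k * coeff g (m - k) \<noteq> 0"
    unfolding coeff_mult using sum.not_neutral_contains_not_neutral by blast
  then have "a \<le> size k" "b \<le> size (m - k)" using assms by (auto simp: order_ge_def)
  then show "a + b \<le> size m" using k(1) by (simp add: size_Diff_submset size_mset_mono le_diff_conv2)
qed

lemma order_ge_mult_right: "order_ge n f \<Longrightarrow> order_ge n (g * f)"
  using order_ge_mult[of 0 g n f] by simp

lemma order_ge_power: "order_ge n f \<Longrightarrow> order_ge (k * n) (f ^ k)"
  by (induction k) (auto intro: order_ge_mult)

lemma order_ge_sum: "(\<And>x. x \<in> A \<Longrightarrow> order_ge n (f x)) \<Longrightarrow> order_ge n (sum f A)"
  by (auto simp: order_ge_def coeff_sum elim!: sum.not_neutral_contains_not_neutral)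

lemma order_ge_has_sum:
  assumes "(f has_sum s) A" "\<And>x. x \<in> A \<Longrightarrow> order_ge n (f x)" shows "order_ge n s"
  unfolding order_ge_def
proof (intro allI impI)
  fix m assume m: "coeff s m \<noteq> 0"
  show "n \<le> size m"
  proof (rule ccontr)
    assume "\<not> n \<le> size m"
    then have "coeff s m = (\<Sum>x\<in>{}. coeff (f x) m)"
      using assms(2) by (intro has_sum_series_coeff[OF assms(1)]) (auto simp: order_ge_def)
    with m show False by simp
  qed
qed

text \<open>The convergence criterion for formal sums: at a monomial \<open>m\<close> only the
  finitely many \<open>x\<close> with \<open>d x \<le> size m\<close> can contribute.\<close>

lemma has_sum_series_exists:
  assumes "\<And>n. finite {x\<in>A. d x \<le> n}" "\<And>x. x \<in> A \<Longrightarrow> order_ge (d x) (f x)"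
  obtains s where "(f has_sum s) A"
proof
  show "(f has_sum Series (\<lambda>m. \<Sum>x | x \<in> A \<and> d x \<le> size m. coeff (f x) m)) A"
    by (rule has_sum_seriesI[where C = "\<lambda>m. {x\<in>A. d x \<le> size m}"])
       (use assms in \<open>auto simp: order_ge_def\<close>)
qed

definition euler :: "series \<Rightarrow> series" where
  "euler f = Series (\<lambda>m. of_nat (size m) * coeff f m)"

lemma coeff_euler [simp]: "coeff (euler f) m = of_nat (size m) * coeff f m"
  by (simp add: euler_def)

lemma local_map_euler: "local_map euler"
  unfolding local_map_def
proof (intro conjI allI)
  fix m
  show "\<exists>M. finite M \<and> (\<forall>f h. (\<forall>k\<in>M. coeff f k = coeff h k) \<longrightarrow> coeff (euler f) m = coeff (euler h) m)"
    by (intro exI[of _ "{m}"]) auto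
qed (auto intro!: series_eqI simp: algebra_simps)

lemmas euler_has_sum = local_map_has_sum[OF local_map_euler]

lemma euler_add: "euler (f + g) = euler f + euler g"
  by (auto intro!: series_eqI simp: algebra_simps)

lemma euler_1 [simp]: "euler 1 = 0" and euler_const [simp]: "euler (const c) = 0"
  by (auto intro!: series_eqI simp: coeff_1 const_def)

text \<open>Leibniz rule: degrees add up whenever a monomial is split into two factors.\<close>

lemma euler_mult: "euler (f * g) = euler f * g + f * euler g"
proof (rule series_eqI)
  fix m
  have "coeff (euler f * g + f * euler g) m = (\<Sum>a | a \<subseteq># m. of_nat (size a + size (m - a)) * (coeff f a * coeff g (m - a)))"
    by (simp add: coeff_mult flip: sum.distrib) (simp add: algebra_simps)
  also have "\<dots> = (\<Sum>a | a \<subseteq># m. of_nat (size m) * (coeff f a * coeff g (m - a)))"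
    by (intro sum.cong) (auto simp: size_Diff_submset size_mset_mono simp del: of_nat_add)
  finally show "coeff (euler (f * g)) m = coeff (euler f * g + f * euler g) m"
    by (simp add: coeff_mult sum_distrib_left)
qed

lemma euler_const_mult: "euler (const c * f) = const c * euler f"
  by (simp add: euler_mult)

lemma euler_power_eigen:
  assumes "euler f = const c * f" shows "euler (f ^ n) = const (of_nat n * c) * f ^ n"
proof (induction n)
  case (Suc n)
  have "euler (f ^ Suc n) = (const c + const (of_nat n * c)) * f ^ Suc n"
    by (simp only: power_Suc euler_mult assms Suc.IH) (simp only: ring_distribs mult.left_commute mult.assoc)
  also have "const c + const (of_nat n * c) = const (of_nat (Suc n) * c)"
    by (simp add: ring_distribs flip: const_add)
  finally show ?case .
qed simp

lemma order_ge_euler: "order_ge n f \<Longrightarrow> order_ge n (euler f)"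
  by (auto simp: order_ge_def)

text \<open>In degree \<open>n > 0\<close> the equation expresses \<open>n\<close> times the
  coefficient of \<open>f\<close> by coefficients of smaller degree. The bound \<open>N\<close> is
  there for comparing a partial product with the limit, since their logarithmic derivatives agree
  only up to some degree.\<close>

lemma euler_eq_unique:
  assumes "euler f = f * u" "euler g = g * v" "order_ge 1 u" "order_ge 1 v"
    and "coeff f {#} = coeff g {#}" "\<And>m. size m \<le> N \<Longrightarrow> coeff u m = coeff v m"
  shows "size m \<le> N \<Longrightarrow> coeff f m = coeff g m"
proof (induction "size m" arbitrary: m rule: less_induct)
  case less
  show ?case
  proof (cases "m = {#}")
    case False
    have "coeff f a * coeff u (m - a) = coeff g a * coeff v (m - a)" if "a \<subseteq># m" for a
    \<comment> \<open>The coefficient at \<open>m\<close> itself meets only the constant term of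
      \<open>u\<close> or \<open>v\<close>, which is 0, so the recursion is well founded.\<close>
    proof (cases "a = m")
      case True
      have "coeff u {#} = 0" "coeff v {#} = 0" using assms(3,4) by (auto simp: order_ge_def)
      then show ?thesis using True by simp
    next
      case False
      then have "size a < size m" using that by (simp add: mset_subset_size subset_mset.less_le)
      moreover have "size (m - a) \<le> N" using less.prems by (meson diff_subset_eq_self size_mset_mono le_trans)
      ultimately show ?thesis using less assms(6) by auto
    qed
    then have "coeff (f * u) m = coeff (g * v) m" by (auto simp: coeff_mult intro!: sum.cong)
    then have "coeff (euler f) m = coeff (euler g) m" by (simp add: assms)
    then show ?thesis using False by simp
  qed (use assms in simp)
qed

section \<open>Plethysm by a single power sum\<close>

lemma coeff_p_plethysm_repeat:
  assumes "n > 0" shows "coeff (p_plethysm n g) (repeat_mset n m) = coeff g m"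
proof -
  have "{m'. repeat_mset n m' = repeat_mset n m} = {m}"
    using assms by (auto simp: repeat_mset_cancel1)
  then show ?thesis by (simp add: p_plethysm_def)
qed

lemma coeff_p_plethysm_nonrepeat:
  assumes "m \<notin> range (repeat_mset n)" shows "coeff (p_plethysm n g) m = 0"
proof -
  have "{m'. repeat_mset n m' = m} = {}" using assms by auto
  then show ?thesis by (simp only: p_plethysm_def coeff_Series sum.empty)
qed

text \<open>For \<open>n > 0\<close> the map \<open>repeat_mset n\<close> is injective, so p_n[g]
  carries the coefficients of \<open>g\<close> on the \<open>n\<close>-th powers of monomials and 0
  elsewhere.\<close>

lemma p_plethysm_eqI:
  assumes "n > 0" "\<And>m. coeff f (repeat_mset n m) = coeff g m"
    and "\<And>m. m \<notin> range (repeat_mset n) \<Longrightarrow> coeff f m = 0"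
  shows "p_plethysm n g = f"
proof (rule series_eqI)
  fix m
  show "coeff (p_plethysm n g) m = coeff f m"
    using assms by (cases "m \<in> range (repeat_mset n)")
      (auto simp: coeff_p_plethysm_repeat coeff_p_plethysm_nonrepeat)
qed

lemma finite_repeat_mset_eq:
  assumes "n > 0" shows "finite {m'. repeat_mset n m' = m}"
proof (cases "m \<in> range (repeat_mset n)")
  case True
  then obtain m1 where "m = repeat_mset n m1" by auto
  then have "{m'. repeat_mset n m' = m} = {m1}"
    using assms by (auto simp: repeat_mset_cancel1)
  then show ?thesis by simp
next
  case False
  then have "{m'. repeat_mset n m' = m} = {}" by auto
  then show ?thesis by simp
qed

lemma local_map_p_plethysm:
  assumes "n > 0" shows "local_map (p_plethysm n)"
  unfolding local_map_def
proof (intro conjI allI)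
  fix f g show "p_plethysm n (f + g) = p_plethysm n f + p_plethysm n g"
    using assms by (intro p_plethysm_eqI)
      (auto simp: coeff_p_plethysm_repeat coeff_p_plethysm_nonrepeat)
next
  fix m :: "nat multiset"
  have "finite {m'. repeat_mset n m' = m}" by (rule finite_repeat_mset_eq[OF assms])
  then show "\<exists>M. finite M \<and> (\<forall>f g. (\<forall>k\<in>M. coeff f k = coeff g k) \<longrightarrow>
      coeff (p_plethysm n f) m = coeff (p_plethysm n g) m)"
    by (intro exI[of _ "{m'. repeat_mset n m' = m}"]) (auto simp: p_plethysm_def intro!: sum.cong)
qed

lemmas p_plethysm_has_sum = local_map_has_sum[OF local_map_p_plethysm]

lemma p_plethysm_add: "n > 0 \<Longrightarrow> p_plethysm n (f + g) = p_plethysm n f + p_plethysm n g"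
  using local_map_p_plethysm unfolding local_map_def by blast

lemma repeat_mset_subseteq_iff: "n > 0 \<Longrightarrow> repeat_mset n a \<subseteq># repeat_mset n b \<longleftrightarrow> a \<subseteq># b"
  by (simp add: subseteq_mset_def)

lemma repeat_mset_diff: "repeat_mset n (a - b) = repeat_mset n a - repeat_mset n b"
  by (rule multiset_eqI) (simp add: diff_mult_distrib2)

text \<open>Splittings of an \<open>n\<close>-th power into factors that are not \<open>n\<close>-th
  powers contribute 0, and a monomial that is not an \<open>n\<close>-th power has no splitting into
  two \<open>n\<close>-th powers.\<close>

lemma p_plethysm_mult:
  assumes "n > 0" shows "p_plethysm n (f * g) = p_plethysm n f * p_plethysm n g"
proof (rule p_plethysm_eqI[OF assms])
  fix m
  have "coeff (p_plethysm n f * p_plethysm n g) (repeat_mset n m) =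
    (\<Sum>a\<in>repeat_mset n ` {a. a \<subseteq># m}. coeff (p_plethysm n f) a * coeff (p_plethysm n g) (repeat_mset n m - a))"
    unfolding coeff_mult
  proof (rule sum.mono_neutral_right)
    show "\<forall>a\<in>{a. a \<subseteq># repeat_mset n m} - repeat_mset n ` {a. a \<subseteq># m}.
       coeff (p_plethysm n f) a * coeff (p_plethysm n g) (repeat_mset n m - a) = 0"
    proof
      fix a assume "a \<in> {a. a \<subseteq># repeat_mset n m} - repeat_mset n ` {a. a \<subseteq># m}"
      then have "a \<notin> range (repeat_mset n)" using assms by (auto simp: repeat_mset_subseteq_iff)
      then show "coeff (p_plethysm n f) a * coeff (p_plethysm n g) (repeat_mset n m - a) = 0"
        by (simp add: coeff_p_plethysm_nonrepeat)
    qed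
  qed (use assms in \<open>auto simp: repeat_mset_subseteq_iff finite_submultisets\<close>)
  also have "\<dots> = (\<Sum>a | a \<subseteq># m. coeff f a * coeff g (m - a))"
    by (subst sum.reindex)
       (use assms in \<open>auto simp: inj_on_def repeat_mset_cancel1 coeff_p_plethysm_repeat
         simp flip: repeat_mset_diff\<close>)
  finally show "coeff (p_plethysm n f * p_plethysm n g) (repeat_mset n m) = coeff (f * g) m"
    by (simp add: coeff_mult)
next
  fix m :: "nat multiset" assume m: "m \<notin> range (repeat_mset n)"
  have "coeff (p_plethysm n f) a * coeff (p_plethysm n g) (m - a) = 0" if "a \<subseteq># m" for a
  proof (rule ccontr)
    assume "coeff (p_plethysm n f) a * coeff (p_plethysm n g) (m - a) \<noteq> 0"
    then have "a \<in> range (repeat_mset n)" "m - a \<in> range (repeat_mset n)"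
      using coeff_p_plethysm_nonrepeat by (metis mult_eq_0_iff)+
    then obtain b c where "a = repeat_mset n b" "m - a = repeat_mset n c" by auto
    then have "m = repeat_mset n (b + c)"
      using that by (metis repeat_mset_distrib2 subset_mset.add_diff_inverse)
    then show False using m by blast
  qed
  then show "coeff (p_plethysm n f * p_plethysm n g) m = 0"
    unfolding coeff_mult by (intro sum.neutral ballI) blast
qed

lemma p_plethysm_const [simp]:
  assumes "n > 0" shows "p_plethysm n (const c) = const c"
  by (rule p_plethysm_eqI[OF assms]) (use assms in \<open>auto simp: const_def repeat_mset_eq_empty_iff\<close>)

lemma p_plethysm_1 [simp]: "n > 0 \<Longrightarrow> p_plethysm n 1 = 1"
  using p_plethysm_const[of n 1] by simp

lemma p_plethysm_0 [simp]: "n > 0 \<Longrightarrow> p_plethysm n 0 = 0"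
  using p_plethysm_const[of n 0] by simp

lemma p_plethysm_const_mult: "n > 0 \<Longrightarrow> p_plethysm n (const c * f) = const c * p_plethysm n f"
  by (simp add: p_plethysm_mult)

lemma p_plethysm_power: "n > 0 \<Longrightarrow> p_plethysm n (f ^ k) = p_plethysm n f ^ k"
  by (induction k) (simp_all add: p_plethysm_mult)

lemma p_plethysm_sum: "n > 0 \<Longrightarrow> p_plethysm n (sum f A) = (\<Sum>x\<in>A. p_plethysm n (f x))"
  by (induction A rule: infinite_finite_induct) (simp_all add: p_plethysm_add)

lemma p_plethysm_one_left [simp]: "p_plethysm (Suc 0) g = g"
  by (rule p_plethysm_eqI) auto

lemma p_plethysm_p_plethysm:
  assumes "n > 0" "k > 0" shows "p_plethysm n (p_plethysm k g) = p_plethysm (n * k) g"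
proof (rule p_plethysm_eqI[OF assms(1)])
  fix m
  show "coeff (p_plethysm (n * k) g) (repeat_mset n m) = coeff (p_plethysm k g) m"
  proof (cases "m \<in> range (repeat_mset k)")
    case True
    then obtain b where "m = repeat_mset k b" by auto
    then show ?thesis
      using coeff_p_plethysm_repeat[of "n * k" g b] coeff_p_plethysm_repeat[of k g b] assms by simp
  next
    case False
    have "repeat_mset n m \<notin> range (repeat_mset (n * k))"
    proof
      assume "repeat_mset n m \<in> range (repeat_mset (n * k))"
      then obtain b where "repeat_mset n m = repeat_mset n (repeat_mset k b)" by auto
      then show False using False assms by (simp add: repeat_mset_cancel1 del: repeat_mset_right)
    qed
    then show ?thesis using False by (simp add: coeff_p_plethysm_nonrepeat)
  qed
next
  fix m :: "nat multiset" assume "m \<notin> range (repeat_mset n)"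
  then have "m \<notin> range (repeat_mset (n * k))" by (auto simp flip: repeat_mset_right)
  then show "coeff (p_plethysm (n * k) g) m = 0" by (rule coeff_p_plethysm_nonrepeat)
qed

subsection \<open>Power sums\<close>

lemma coeff_p_sym: "coeff (p_sym n) m = (if \<exists>i. m = replicate_mset n i then 1 else 0)"
  by (simp add: p_sym_def)

lemma p_plethysm_p_sym:
  assumes "n > 0" shows "p_plethysm n (p_sym k) = p_sym (n * k)"
proof (rule p_plethysm_eqI[OF assms])
  have *: "replicate_mset (n * k) i = repeat_mset n (replicate_mset k i)" for i :: nat
    by (rule multiset_eqI) simp
  show "coeff (p_sym (n * k)) (repeat_mset n m) = coeff (p_sym k) m" for m
    unfolding coeff_p_sym * repeat_mset_cancel1 using assms by simp
  show "coeff (p_sym (n * k)) m = 0" if "m \<notin> range (repeat_mset n)" for m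
    unfolding coeff_p_sym * using that by auto
qed

text \<open>Chain rule: p_n multiplies the degree of each monomial by \<open>n\<close>.\<close>

lemma euler_p_plethysm:
  assumes "n > 0" shows "euler (p_plethysm n g) = const (of_nat n) * p_plethysm n (euler g)"
proof (rule series_eqI)
  fix m
  show "coeff (euler (p_plethysm n g)) m = coeff (const (of_nat n) * p_plethysm n (euler g)) m"
  proof (cases "m \<in> range (repeat_mset n)")
    case True
    then obtain b where "m = repeat_mset n b" by auto
    then show ?thesis
      using assms by (simp add: coeff_p_plethysm_repeat)
  qed (simp add: coeff_p_plethysm_nonrepeat)
qed

lemma order_ge_p_plethysm:
  assumes "n > 0" "order_ge k g" shows "order_ge (n * k) (p_plethysm n g)"
  unfolding order_ge_def
proof (intro allI impI)
  fix m assume m: "coeff (p_plethysm n g) m \<noteq> 0"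
  then obtain b where "m = repeat_mset n b"
    using coeff_p_plethysm_nonrepeat by (metis imageE)
  then show "n * k \<le> size m" using m assms by (simp add: coeff_p_plethysm_repeat order_ge_def)
qed

lemma order_ge_p_plethysm1:
  assumes "n > 0" "order_ge 1 g" shows "order_ge n (p_plethysm n g)"
  using order_ge_p_plethysm[OF assms] by simp

lemma order_ge_p_sym: "order_ge n (p_sym n)"
  by (auto simp: order_ge_def coeff_p_sym)

lemma euler_p_sym: "euler (p_sym n) = const (of_nat n) * p_sym n"
  by (rule series_eqI) (auto simp: coeff_p_sym)

lemma finite_count_ge: "k > 0 \<Longrightarrow> finite {i. k \<le> count m i}"
  by (rule finite_subset[of _ "set_mset m"]) (auto simp flip: count_greater_zero_iff)

text \<open>The sum runs over the variable whose \<open>k\<close>-th power is split off from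
  \<open>m\<close>. For \<open>k > 0\<close> different variables give different powers, and only
  finitely many of them divide \<open>m\<close>.\<close>

lemma coeff_p_sym_mult:
  assumes "k > 0"
  shows "coeff (p_sym k * f) m = (\<Sum>i | k \<le> count m i. coeff f (m - replicate_mset k i))"
proof -
  have "coeff (p_sym k * f) m =
    (\<Sum>a\<in>replicate_mset k ` {i. k \<le> count m i}. coeff (p_sym k) a * coeff f (m - a))"
    unfolding coeff_mult
    by (rule sum.mono_neutral_right)
      (auto simp: finite_submultisets coeff_p_sym count_le_replicate_mset_subset_eq)
  also have "\<dots> = (\<Sum>i | k \<le> count m i. coeff f (m - replicate_mset k i))"
    by (subst sum.reindex) (use assms in \<open>auto simp: inj_on_def coeff_p_sym
        replicate_mset_eq_iff intro!: sum.cong\<close>)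
  finally show ?thesis .
qed

section \<open>Linear independence of the products of power sums\<close>

definition exponents :: "nat multiset \<Rightarrow> nat multiset" where
  "exponents m = image_mset (count m) (mset_set (set_mset m))"

lemma size_exponents: "size (exponents m) = card (set_mset m)"
  by (simp add: exponents_def)

lemma exponents_remove:
  assumes "i \<in># m"
  shows "exponents m = add_mset (count m i) (exponents (m - replicate_mset (count m i) i))"
proof -
  let ?m = "m - replicate_mset (count m i) i"
  have s: "set_mset ?m = set_mset m - {i}"
    by (auto simp flip: count_greater_zero_iff split: if_splits)
  have "mset_set (set_mset m) = add_mset i (mset_set (set_mset m - {i}))"
    using assms by (simp add: mset_set.remove)
  moreover have "image_mset (count m) (mset_set (set_mset m - {i})) = image_mset (count ?m) (mset_set (set_mset m - {i}))"
    by (rule image_mset_cong) auto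
  ultimately show ?thesis unfolding exponents_def s by simp
qed

abbreviation p_prod :: "nat multiset \<Rightarrow> series" where
  "p_prod l \<equiv> (\<Prod>k\<in>#l. p_sym k)"

lemma coeff_p_prod_nonneg: "l \<in> partitions \<Longrightarrow> coeff (p_prod l) m \<ge> 0"
proof (induction l arbitrary: m)
  case (add k l)
  then have "k > 0" "l \<in> partitions" by (auto simp: partitions_def)
  then show ?case using add.IH by (auto simp: coeff_p_sym_mult intro!: sum_nonneg)
qed (simp add: coeff_1)

text \<open>A monomial of \<open>p_prod l\<close> arises by choosing a variable for each part of
  \<open>l\<close>. Parts with the same variable merge into one exponent, so there are at most
  \<open>size l\<close> exponents, with equality only if nothing merges.\<close>

lemma coeff_p_prod_nonzero:
  "l \<in> partitions \<Longrightarrow> coeff (p_prod l) m \<noteq> 0 \<Longrightarrow>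
     size m = sum_mset l \<and> size (exponents m) \<le> size l \<and> (size (exponents m) = size l \<longrightarrow> exponents m = l)"
proof (induction l arbitrary: m)
  case empty
  then show ?case by (simp add: coeff_1 exponents_def split: if_splits)
next
  case (add k l)
  then have k: "k > 0" "l \<in> partitions" by (auto simp: partitions_def)
  with add.prems obtain i where i: "k \<le> count m i" "coeff (p_prod l) (m - replicate_mset k i) \<noteq> 0"
    by (auto simp: coeff_p_sym_mult elim: sum.not_neutral_contains_not_neutral)
  let ?m = "m - replicate_mset k i"
  note IH = add.IH[OF k(2) i(2)]
  have sub: "replicate_mset k i \<subseteq># m"
    using i by (simp add: count_le_replicate_mset_subset_eq)
  then have "size ?m = size m - k" "k \<le> size m"
    using size_mset_mono[OF sub] by (simp_all add: size_Diff_submset)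
  then have 1: "size m = sum_mset (add_mset k l)" using IH by simp
  show ?case
  proof (cases "count m i = k")
    case True
    then have "i \<in># m" using k by (simp flip: count_greater_zero_iff)
    from exponents_remove[OF this] show ?thesis using IH 1 True by simp
  next
    case False
    have "set_mset ?m = set_mset m"
      using False i by (auto simp flip: count_greater_zero_iff split: if_splits)
    then have "size (exponents ?m) = size (exponents m)" by (simp add: size_exponents)
    then show ?thesis using IH 1 by simp
  qed
qed

lemma exponents_partition: "exponents m \<in> partitions"
  by (auto simp: exponents_def partitions_def count_eq_zero_iff)

text \<open>Giving each exponent to its own variable produces \<open>m\<close> at least once, and no
  cancellation occurs because all coefficients are nonnegative.\<close>

lemma coeff_p_prod_exponents: "coeff (p_prod (exponents m)) m > 0"
proof (induction "size m" arbitrary: m rule: less_induct)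
  case less
  show ?case
  proof (cases "m = {#}")
    case False
    then obtain i where i: "i \<in># m" by blast
    let ?k = "count m i"
    let ?m = "m - replicate_mset ?k i"
    have k: "?k > 0" using i by simp
    have "size ?m < size m"
      using i by (intro mset_subset_size) (auto simp: subset_mset.less_le multiset_eq_iff)
    then have pos: "coeff (p_prod (exponents ?m)) ?m > 0" by (rule less)
    have "0 < (\<Sum>j | ?k \<le> count m j. coeff (p_prod (exponents ?m)) (m - replicate_mset ?k j))"
      using pos k by (intro sum_pos2[of _ i])
        (auto intro: coeff_p_prod_nonneg exponents_partition finite_count_ge)
    then show ?thesis
      unfolding exponents_remove[OF i] by (simp add: coeff_p_sym_mult k del: count_greater_zero_iff)
  qed (simp add: exponents_def coeff_1)
qed

text \<open>Here the supply of variables must be infinite: each new part gets a fresh one.\<close>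

lemma exponents_surj: "l \<in> partitions \<Longrightarrow> \<exists>m. exponents m = l"
proof (induction l)
  case empty
  then show ?case by (intro exI[of _ "{#}"]) (simp add: exponents_def)
next
  case (add k l)
  then have k: "k > 0" and "l \<in> partitions" by (auto simp: partitions_def)
  with add.IH obtain m where m: "exponents m = l" by blast
  obtain i where i: "i \<notin># m"
    using ex_new_if_finite[OF infinite_UNIV_nat, of "set_mset m"] by auto
  then have c: "count (m + replicate_mset k i) i = k" by (simp add: not_in_iff)
  then have "i \<in># m + replicate_mset k i" using k by (metis count_greater_zero_iff)
  from exponents_remove[OF this, unfolded c] show ?case using m by auto
qed

lemma size_le_sum_mset: "l \<in> partitions \<Longrightarrow> size l \<le> sum_mset l"
  by (induction l) (auto simp: partitions_def Suc_le_eq intro: add_less_le_mono)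

text \<open>At a monomial with exponents \<open>l\<close>, only \<open>p_prod l\<close> and products of more factors can have a
  nonzero coefficient; so a vanishing combination has no term with the largest number of factors.\<close>

lemma p_prod_independent:
  assumes "((\<lambda>l. const (c l) * p_prod l) has_sum 0) partitions" "l \<in> partitions"
  shows "c l = 0"
proof (rule ccontr)
  assume "c l \<noteq> 0"
  \<comment> \<open>The combination may be infinite, so a largest number of parts need not exist
    overall. Within one degree it does, as that number is bounded by the degree.\<close>
  define P where "P l' \<longleftrightarrow> l' \<in> partitions \<and> c l' \<noteq> 0 \<and> sum_mset l' = sum_mset l" for l'
  have "\<forall>l'. P l' \<longrightarrow> size l' < Suc (sum_mset l)"
    unfolding P_def using size_le_sum_mset le_imp_less_Suc by metis
  moreover have "P l" using assms \<open>c l \<noteq> 0\<close> by (simp add: P_def)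
  ultimately obtain q where q: "P q" "\<forall>l'. P l' \<longrightarrow> size l' \<le> size q"
    using ex_has_greatest_nat[of P l size "Suc (sum_mset l)"] by auto
  obtain m where m: "exponents m = q" using q(1) exponents_surj unfolding P_def by blast
  have pos: "coeff (p_prod q) m > 0" using coeff_p_prod_exponents[of m] m by simp
  have qp: "q \<in> partitions" "c q \<noteq> 0" "sum_mset q = sum_mset l" using q(1) by (auto simp: P_def)
  have "coeff 0 m = (\<Sum>l\<in>{q}. coeff (const (c l) * p_prod l) m)"
  proof (rule has_sum_series_coeff[OF assms(1)])
    fix l' assume l': "l' \<in> partitions" "coeff (const (c l') * p_prod l') m \<noteq> 0"
    then have n: "c l' \<noteq> 0" "coeff (p_prod l') m \<noteq> 0" by auto
    note * = coeff_p_prod_nonzero[OF l'(1) n(2)] coeff_p_prod_nonzero[OF qp(1) less_imp_neq[OF pos, symmetric]]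
    then have "P l'" using n l' qp by (auto simp: P_def)
    then have "size l' \<le> size q" using q by blast
    then show "l' \<in> {q}" using * m by auto
  qed (use qp in auto)
  then show False using pos qp by simp
qed

subsection \<open>Evaluating plethysms\<close>

abbreviation p_prod_plethysm :: "nat multiset \<Rightarrow> series \<Rightarrow> series" where
  "p_prod_plethysm l g \<equiv> (\<Prod>k\<in>#l. p_plethysm k g)"

text \<open>Two expansions of \<open>f\<close> differ by an expansion of 0, so by
  \<open>p_prod_independent\<close> their coefficients agree and the value in the definition of
  plethysm is unique.\<close>

lemma plethysm_eqI:
  assumes "((\<lambda>l. const (c l) * p_prod l) has_sum f) partitions"
    and "((\<lambda>l. const (c l) * p_prod_plethysm l g) has_sum r) partitions"
  shows "f\<lbrakk>g\<rbrakk> = r"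
  unfolding plethysm_def
proof (rule the_equality)
  fix r'
  assume "\<exists>c. ((\<lambda>l. const (c l) * p_prod l) has_sum f) partitions \<and>
     ((\<lambda>l. const (c l) * p_prod_plethysm l g) has_sum r') partitions"
  then obtain c' where c': "((\<lambda>l. const (c' l) * p_prod l) has_sum f) partitions"
     "((\<lambda>l. const (c' l) * p_prod_plethysm l g) has_sum r') partitions" by (elim exE conjE)
  have "((\<lambda>l. const (c l) * p_prod l + const (-1) * (const (c' l) * p_prod l)) has_sum
     (f + const (-1) * f)) partitions"
    by (intro has_sum_add has_sum_series_cmult assms c')
  also have "(\<lambda>l. const (c l) * p_prod l + const (-1) * (const (c' l) * p_prod l)) =
     (\<lambda>l. const (c l - c' l) * p_prod l)"
    by (intro ext series_eqI) (simp add: left_diff_distrib)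
  also have "f + const (-1) * f = 0"
    by (simp add: const_minus)
  finally have "\<And>l. l \<in> partitions \<Longrightarrow> c l - c' l = 0" by (rule p_prod_independent)
  then have "((\<lambda>l. const (c l) * p_prod_plethysm l g) has_sum r') partitions"
    using c'(2) by (subst has_sum_cong[where g = "\<lambda>l. const (c' l) * p_prod_plethysm l g"]) auto
  then show "r' = r" using assms(2) has_sum_unique by blast
qed (use assms in blast)

text \<open>Allows expansions indexed by something more convenient than partitions, such as pairs
  \<open>(d, j)\<close>; the coefficients are extended by 0 outside the image of
  \<open>l\<close>.\<close>

lemma plethysm_eqI_inj:
  assumes "inj_on l A" "l ` A \<subseteq> partitions"
    and "((\<lambda>x. const (a x) * p_prod (l x)) has_sum f) A"
    and "((\<lambda>x. const (a x) * p_prod_plethysm (l x) g) has_sum r) A"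
  shows "f\<lbrakk>g\<rbrakk> = r"
proof (rule plethysm_eqI)
  define c where "c q = (if q \<in> l ` A then a (inv_into A l q) else 0)" for q
  have *: "((\<lambda>q. const (c q) * u q) has_sum s) partitions"
    if "((\<lambda>x. const (a x) * u (l x)) has_sum s) A" for u s
  proof -
    have "((\<lambda>q. const (c q) * u q) has_sum s) (l ` A)"
      unfolding has_sum_reindex[OF assms(1)] using that
      by (subst has_sum_cong[where g = "\<lambda>x. const (a x) * u (l x)"])
        (auto simp: c_def inv_into_f_f[OF assms(1)])
    then show ?thesis
      using assms(2) by (subst has_sum_cong_neutral[where T = "l ` A" and g = "\<lambda>q. const (c q) * u q"])
        (auto simp: c_def)
  qed
  show "((\<lambda>q. const (c q) * p_prod q) has_sum f) partitions"
    "((\<lambda>q. const (c q) * p_prod_plethysm q g) has_sum r) partitions"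
    by (rule *; rule assms)+
qed

text \<open>For \<open>w = 1\<close> this is the coefficient \<open>1 / z\<^sub>l\<close> of \<open>p_prod l\<close> in \<open>H\<close>; for \<open>w = sgn_wt\<close> below it is the one in \<open>E\<close>.\<close>

definition z_inv :: "(nat \<Rightarrow> rat) \<Rightarrow> nat multiset \<Rightarrow> rat" where
  "z_inv w l = (\<Prod>k\<in>set_mset l. (w k / of_nat k) ^ count l k / fact (count l k))"

text \<open>Only the factor at \<open>k\<close> changes, from a term of the exponential series to
  its predecessor. This identity makes the sum with coefficients \<open>z_inv w\<close> behave like
  an exponential.\<close>

lemma z_inv_remove:
  assumes "k \<in># l" "k > 0"
  shows "of_nat (count l k * k) * z_inv w l = w k * z_inv w (l - {#k#})"
proof -
  define t where "t j c = (w j / of_nat j) ^ c / fact c" for j c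
  define R where "R = (\<Prod>j\<in>set_mset l - {k}. t j (count l j))"
  obtain n where n: "count l k = Suc n" using assms by (meson count_greater_zero_iff gr0_implies_Suc)
  have "z_inv w l = t k (Suc n) * R"
    unfolding z_inv_def R_def t_def using assms(1) n by (subst prod.remove[of _ k]) auto
  \<comment> \<open>If \<open>k\<close> occurs only once, it leaves the support. Its factor is then
    1, so the product may still run over \<open>set_mset l\<close>.\<close>
  moreover have "z_inv w (l - {#k#}) = (\<Prod>j\<in>set_mset l. t j (count (l - {#k#}) j))"
    unfolding z_inv_def t_def
    by (rule prod.mono_neutral_left) (auto simp: not_in_iff dest: in_diffD)
  then have "z_inv w (l - {#k#}) = t k n * R"
    unfolding R_def using assms(1) n by (subst (asm) prod.remove[of _ k]) (auto intro!: prod.cong)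
  moreover have "t k (Suc n) = w k / of_nat k * t k n / of_nat (Suc n)"
    by (simp only: t_def power_Suc fact_Suc) (simp del: of_nat_Suc)
  then have "of_nat (Suc n * k) * t k (Suc n) = w k * t k n"
    unfolding of_nat_mult using assms(2) by (simp add: field_simps del: of_nat_Suc)
  ultimately show ?thesis using n by simp
qed

lemma z_inv_empty [simp]: "z_inv w {#} = 1"
  by (simp add: z_inv_def)

lemma finite_partitions_sum_le: "finite {l \<in> partitions. sum_mset l \<le> n}"
proof (rule finite_subset)
  show "{l \<in> partitions. sum_mset l \<le> n} \<subseteq> mset ` {xs. set xs \<subseteq> {..n} \<and> length xs \<le> n}"
  proof
    fix l assume l: "l \<in> {l \<in> partitions. sum_mset l \<le> n}"
    obtain xs where xs: "l = mset xs" using ex_mset by metis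
    have "length xs \<le> n" using l size_le_sum_mset[of l] xs by simp
    moreover have "x \<le> n" if "x \<in> set xs" for x
      using l xs that member_le_sum_list[of x xs] by (simp add: sum_mset_sum_list)
    ultimately show "l \<in> mset ` {xs. set xs \<subseteq> {..n} \<and> length xs \<le> n}"
      using xs by auto
  qed
qed (simp add: finite_lists_length_le)

lemma order_ge_p_prod_plethysm:
  "l \<in> partitions \<Longrightarrow> order_ge 1 g \<Longrightarrow> order_ge (sum_mset l) (p_prod_plethysm l g)"
  by (induction l) (auto simp: partitions_def intro!: order_ge_mult order_ge_p_plethysm1)

lemma partitions_add_mset [simp]: "add_mset k l \<in> partitions \<longleftrightarrow> k > 0 \<and> l \<in> partitions"
  by (auto simp: partitions_def)

lemma partitions_empty [simp]: "{#} \<in> partitions"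
  by (simp add: partitions_def)

lemma euler_p_prod_plethysm_sum_mset:
  "l \<in> partitions \<Longrightarrow> euler (p_prod_plethysm l g) =
     (\<Sum>k\<in>#l. const (of_nat k) * p_plethysm k (euler g) * p_prod_plethysm (l - {#k#}) g)"
proof (induction l)
  case (add a l)
  let ?f = "\<lambda>k. const (of_nat k) * p_plethysm k (euler g)"
  have "(\<Sum>k\<in>#l. ?f k * p_prod_plethysm (add_mset a l - {#k#}) g) =
     (\<Sum>k\<in>#l. p_plethysm a g * (?f k * p_prod_plethysm (l - {#k#}) g))"
    by (intro arg_cong[where f = sum_mset] image_mset_cong) (simp add: algebra_simps)
  also have "\<dots> = p_plethysm a g * euler (p_prod_plethysm l g)"
    using add by (simp add: sum_mset_distrib_left)
  finally show ?case
    using add.prems by (simp add: euler_mult euler_p_plethysm)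
qed simp

lemma sum_mset_image_count:
  fixes f :: "'a \<Rightarrow> 'b::comm_semiring_1"
  assumes "finite S" "set_mset M \<subseteq> S"
  shows "(\<Sum>x\<in>#M. f x) = (\<Sum>x\<in>S. of_nat (count M x) * f x)"
  using assms(2)
proof (induction M)
  case (add a M)
  have "(\<Sum>x\<in>S. of_nat (count (add_mset a M) x) * f x) =
     (\<Sum>x\<in>S. (if x = a then f x else 0) + of_nat (count M x) * f x)"
    by (rule sum.cong) (auto simp: algebra_simps)
  also have "\<dots> = f a + (\<Sum>x\<in>S. of_nat (count M x) * f x)"
    using add.prems assms(1) by (simp add: sum.distrib)
  finally show ?case using add by simp
qed simp

text \<open>Equal parts are collected in the Leibniz rule; their multiplicity and the chain rule
  factor \<open>k\<close> together are what \<open>z_inv_remove\<close> absorbs.\<close>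

lemma euler_p_prod_plethysm:
  assumes "l \<in> partitions"
  shows "const (z_inv w l) * euler (p_prod_plethysm l g) =
     (\<Sum>k\<in>set_mset l. const (z_inv w (l - {#k#})) * p_prod_plethysm (l - {#k#}) g *
        (const (w k) * p_plethysm k (euler g)))"
proof -
  have "const (z_inv w l) * (of_nat (count l k) * (const (of_nat k) * p_plethysm k (euler g) * p_prod_plethysm (l - {#k#}) g)) =
     const (z_inv w (l - {#k#})) * p_prod_plethysm (l - {#k#}) g * (const (w k) * p_plethysm k (euler g))"
    if "k \<in># l" for k
  proof -
    have "k > 0" using that assms by (cases k) (auto simp: partitions_def)
    have "const (z_inv w l) * of_nat (count l k) * const (of_nat k) = const (of_nat (count l k * k) * z_inv w l)"
      by (simp add: of_nat_series mult_ac flip: const_mult)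
    also have "\<dots> = const (z_inv w (l - {#k#})) * const (w k)"
      unfolding z_inv_remove[OF that \<open>k > 0\<close>] by (simp add: mult_ac flip: const_mult)
    finally have "const (z_inv w l) * of_nat (count l k) * const (of_nat k) * (p_plethysm k (euler g) * p_prod_plethysm (l - {#k#}) g) =
      const (z_inv w (l - {#k#})) * const (w k) * (p_plethysm k (euler g) * p_prod_plethysm (l - {#k#}) g)"
      by (rule arg_cong)
    then show ?thesis by (simp only: mult_ac)
  qed
  then show ?thesis
    unfolding euler_p_prod_plethysm_sum_mset[OF assms] sum_mset_image_count[OF finite_set_mset order_refl]
      sum_distrib_left by (intro sum.cong) auto
qed

text \<open>Removing one part \<open>k\<close> from \<open>l\<close> identifies the pairs \<open>(l, k)\<close> with \<open>k \<in># l\<close> with all pairs of a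
  partition and a positive integer, which turns the derivative of the sum into a product.\<close>

lemma exp_sum_ode:
  assumes g: "order_ge 1 g"
    and X: "((\<lambda>l. const (z_inv w l) * p_prod_plethysm l g) has_sum X) partitions"
    and V: "((\<lambda>k. const (w k) * p_plethysm k (euler g)) has_sum V) {1..}"
  shows "euler X = X * V" "coeff X {#} = 1"
proof -
  define t where "t = (\<lambda>(l, k). const (z_inv w l) * p_prod_plethysm l g * (const (w k) * p_plethysm k (euler g)))"
  obtain s where s: "(t has_sum s) (partitions \<times> {1..})"
  proof (rule has_sum_series_exists[of "partitions \<times> {1..}" "\<lambda>(l, k). sum_mset l + k" t])
    fix n
    show "finite {x \<in> partitions \<times> {1..}. (case x of (l, k) \<Rightarrow> sum_mset l + k) \<le> n}"
      by (rule finite_subset[of _ "{l \<in> partitions. sum_mset l \<le> n} \<times> {..n}"])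
        (auto simp: finite_partitions_sum_le)
  next
    fix x :: "nat multiset \<times> nat" assume "x \<in> partitions \<times> {1..}"
    then show "order_ge (case x of (l, k) \<Rightarrow> sum_mset l + k) (t x)"
      using g by (auto simp: t_def intro!: order_ge_mult[OF order_ge_mult_right order_ge_mult_right]
        order_ge_p_prod_plethysm order_ge_p_plethysm1 order_ge_euler)
  qed
  have "((\<lambda>l. const (z_inv w l) * p_prod_plethysm l g * V) has_sum s) partitions"
    \<comment> \<open>The double sum \<open>s\<close> is evaluated first over \<open>k\<close>,
      which gives the product. Below, the same \<open>s\<close> is reindexed to give the
      derivative.\<close>
    by (rule has_sum_series_Sigma[OF s]) (simp only: t_def prod.case, intro has_sum_series_cmult V)
  moreover have "((\<lambda>l. const (z_inv w l) * p_prod_plethysm l g * V) has_sum V * X) partitions"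
    using has_sum_series_cmult[OF X, of V] by (simp add: mult_ac)
  ultimately have sV: "s = V * X" by (rule has_sum_unique)
  have "((\<lambda>(l, k). t (l - {#k#}, k)) has_sum s) (Sigma partitions set_mset)"
    using s
    by (subst has_sum_reindex_bij_witness[where T = "partitions \<times> {1..}" and h = t and
          j = "\<lambda>(l, k). (l - {#k#}, k)" and i = "\<lambda>(l, k). (add_mset k l, k)" and s' = s])
      (auto simp: partitions_def Suc_le_eq dest: in_diffD intro: gr0I)
  then have "((\<lambda>l. const (z_inv w l) * euler (p_prod_plethysm l g)) has_sum s) partitions"
    by (rule has_sum_series_Sigma)
      (auto simp: euler_p_prod_plethysm t_def intro!: has_sum_finiteI)
  moreover have "((\<lambda>l. const (z_inv w l) * euler (p_prod_plethysm l g)) has_sum euler X) partitions"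
    using euler_has_sum[OF X] by (simp add: euler_const_mult)
  ultimately have "euler X = s" by (metis has_sum_unique)
  then show "euler X = X * V" using sV by (simp add: mult.commute)
  have "coeff X {#} = (\<Sum>l\<in>{{#}}. coeff (const (z_inv w l) * p_prod_plethysm l g) {#})"
  proof (rule has_sum_series_coeff[OF X])
    fix l assume l: "l \<in> partitions" "coeff (const (z_inv w l) * p_prod_plethysm l g) {#} \<noteq> 0"
    then have "sum_mset l \<le> 0"
      using order_geD[OF order_ge_p_prod_plethysm[OF l(1) g], of "{#}"] by auto
    then have "size l = 0" using size_le_sum_mset[OF l(1)] by linarith
    then show "l \<in> {{#}}" by simp
  qed auto
  then show "coeff X {#} = 1" by (simp add: coeff_1)
qed

lemma exp_sum_exists:
  assumes "order_ge 1 g"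
  obtains X where "((\<lambda>l. const (z_inv w l) * p_prod_plethysm l g) has_sum X) partitions"
proof (rule has_sum_series_exists[of partitions sum_mset "\<lambda>l. const (z_inv w l) * p_prod_plethysm l g"])
  show "order_ge (sum_mset l) (const (z_inv w l) * p_prod_plethysm l g)" if "l \<in> partitions" for l
    using that assms by (intro order_ge_mult_right order_ge_p_prod_plethysm)
qed (use that finite_partitions_sum_le in auto)

lemma p_plethysm_p1: "k > 0 \<Longrightarrow> p_plethysm k (p_sym (Suc 0)) = p_sym k"
  by (simp add: p_plethysm_p_sym)

lemma p_prod_plethysm_p1: "l \<in> partitions \<Longrightarrow> p_prod_plethysm l (p_sym (Suc 0)) = p_prod l"
  by (induction l) (simp_all add: p_plethysm_p1)

text \<open>The equation and the constant term determine \<open>f\<close>, so it equals the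
  exponential type sum taken at \<open>g\<close> = p_1. This yields the power sum expansion of
  \<open>f\<close> with coefficients \<open>z_inv w\<close>, and \<open>exp_sum_ode\<close> then
  applies to the same sum at \<open>g\<close>.\<close>

lemma plethysm_ode:
  assumes V0: "((\<lambda>k. const (w k) * p_sym k) has_sum V0) {1..}"
    and f: "euler f = f * V0" "coeff f {#} = 1"
    and g: "order_ge 1 g"
    and V: "((\<lambda>k. const (w k) * p_plethysm k (euler g)) has_sum V) {1..}"
  shows "euler (f\<lbrakk>g\<rbrakk>) = f\<lbrakk>g\<rbrakk> * V" "coeff (f\<lbrakk>g\<rbrakk>) {#} = 1"
proof -
  have p1: "order_ge 1 (p_sym (Suc 0))" using order_ge_p_sym[of 1] by simp
  have Dp1: "euler (p_sym (Suc 0)) = p_sym (Suc 0)" by (simp add: euler_p_sym)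
  obtain X0 where X0: "((\<lambda>l. const (z_inv w l) * p_prod_plethysm l (p_sym (Suc 0))) has_sum X0) partitions"
    using exp_sum_exists[OF p1] by blast
  have V0': "((\<lambda>k. const (w k) * p_plethysm k (euler (p_sym (Suc 0)))) has_sum V0) {1..}"
    using V0 by (subst has_sum_cong[where g = "\<lambda>k. const (w k) * p_sym k"]) (auto simp: Dp1 p_plethysm_p1)
  have ord: "order_ge 1 V0"
    by (rule order_ge_has_sum[OF V0]) (auto intro!: order_ge_mult_right order_ge_mono[OF order_ge_p_sym])
  have "coeff X0 m = coeff f m" for m
    by (rule euler_eq_unique[OF exp_sum_ode(1)[OF p1 X0 V0'] f(1), where N = "size m"])
      (use ord exp_sum_ode(2)[OF p1 X0 V0'] f(2) in simp_all)
  then have "X0 = f" by (rule series_eqI)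
  then have "((\<lambda>l. const (z_inv w l) * p_prod l) has_sum f) partitions"
    using X0 by (subst has_sum_cong[where g = "\<lambda>l. const (z_inv w l) * p_prod_plethysm l (p_sym (Suc 0))"])
      (auto simp: p_prod_plethysm_p1)
  moreover obtain X where X: "((\<lambda>l. const (z_inv w l) * p_prod_plethysm l g) has_sum X) partitions"
    using exp_sum_exists[OF g] by blast
  ultimately have "f\<lbrakk>g\<rbrakk> = X" by (rule plethysm_eqI)
  then show "euler (f\<lbrakk>g\<rbrakk>) = f\<lbrakk>g\<rbrakk> * V" "coeff (f\<lbrakk>g\<rbrakk>) {#} = 1"
    using exp_sum_ode[OF g X V] by auto
qed

section \<open>Logarithmic derivatives of H and E\<close>

lemma coeff_H: "coeff H m = 1"
proof -
  have "(h_sym has_sum Series (\<lambda>_. 1)) UNIV"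
    by (rule has_sum_seriesI[where C = "\<lambda>m. {size m}"]) (auto simp: h_sym_def split: if_splits)
  then show ?thesis by (simp add: H_def infsumI)
qed

lemma coeff_E: "coeff E m = (if \<forall>i. count m i \<le> 1 then 1 else 0)"
proof -
  have "(e_sym has_sum Series (\<lambda>m. if \<forall>i. count m i \<le> 1 then 1 else 0)) UNIV"
    by (rule has_sum_seriesI[where C = "\<lambda>m. {size m}"]) (auto simp: e_sym_def split: if_splits)
  then show ?thesis by (simp add: E_def infsumI)
qed

text \<open>Grouping by the variable whose power is split off lets the equations for
  \<open>H\<close> and \<open>E\<close> be checked one variable at a time.\<close>

lemma coeff_mult_power_sum:
  assumes V: "((\<lambda>k. const (w k) * p_sym k) has_sum V) {1..}"
  shows "coeff (f * V) m =
    (\<Sum>i\<in>set_mset m. \<Sum>k=1..count m i. w k * coeff f (m - replicate_mset k i))"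
proof -
  have *: "coeff (f * (const (w k) * p_sym k)) m =
      (\<Sum>i | i \<in> set_mset m \<and> k \<le> count m i. w k * coeff f (m - replicate_mset k i))"
    if "k \<ge> 1" for k
  proof -
    have "{i. k \<le> count m i} = {i. i \<in> set_mset m \<and> k \<le> count m i}"
      using that by (auto simp flip: count_greater_zero_iff)
    then have "coeff (p_sym k * f) m = (\<Sum>i | i \<in> set_mset m \<and> k \<le> count m i. coeff f (m - replicate_mset k i))"
      using that coeff_p_sym_mult[of k f m] by simp
    moreover have "f * (const (w k) * p_sym k) = const (w k) * (p_sym k * f)" by (simp add: mult_ac)
    ultimately show ?thesis by (simp only: coeff_const_mult sum_distrib_left)
  qed
  have "coeff (f * V) m = (\<Sum>k\<in>{1..size m}. coeff (f * (const (w k) * p_sym k)) m)"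
  proof (rule has_sum_series_coeff[OF has_sum_series_cmult[OF V]])
    fix k :: nat assume "k \<in> {1..}" "coeff (f * (const (w k) * p_sym k)) m \<noteq> 0"
    then show "k \<in> {1..size m}"
      using order_geD[OF order_ge_mult_right[OF order_ge_mult_right[OF order_ge_p_sym]]] by auto
  qed auto
  also have "\<dots> = (\<Sum>k\<in>{1..size m}. \<Sum>i | i \<in> set_mset m \<and> k \<le> count m i. w k * coeff f (m - replicate_mset k i))"
    by (rule sum.cong) (auto simp: *)
  also have "\<dots> = (\<Sum>i\<in>set_mset m. \<Sum>k | k \<in> {1..size m} \<and> k \<le> count m i. w k * coeff f (m - replicate_mset k i))"
    by (rule sum.swap_restrict) auto
  also have "\<dots> = (\<Sum>i\<in>set_mset m. \<Sum>k=1..count m i. w k * coeff f (m - replicate_mset k i))"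
    using count_le_size[of m] by (intro sum.cong) (auto intro: order_trans)
  finally show ?thesis .
qed

lemma size_conv_sum_count: "size m = (\<Sum>i\<in>set_mset m. count m i)"
  by (rule size_multiset_overloaded_eq)

text \<open>With all coefficients 1, each variable contributes its exponent, and the exponents add
  up to the degree.\<close>

lemma euler_H:
  assumes V: "((\<lambda>k. const 1 * p_sym k) has_sum V) {1..}"
  shows "euler H = H * V"
  by (rule series_eqI, subst coeff_mult_power_sum[OF V]) (simp add: coeff_H size_conv_sum_count)

definition sgn_wt :: "nat \<Rightarrow> rat" where
  "sgn_wt k = (if even k then - 1 else 1)"

text \<open>If \<open>i\<close> has exponent 1, there is one term, with \<open>k = 1\<close>.
  Otherwise \<open>m\<close> has coefficient 0 in \<open>E\<close>, and the only possible terms,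
  those leaving exponent 1 or 0 at \<open>i\<close>, cancel.\<close>

lemma sum_sgn_wt_E:
  assumes "i \<in># m"
  shows "(\<Sum>k=1..count m i. sgn_wt k * coeff E (m - replicate_mset k i)) = coeff E m"
proof -
  obtain n where n: "count m i = Suc n" using assms by (meson count_greater_zero_iff gr0_implies_Suc)
  show ?thesis
  proof (cases n)
    case 0
    have "(\<forall>j. count (m - {#i#}) j \<le> 1) \<longleftrightarrow> (\<forall>j. count m j \<le> 1)"
    proof (intro iff_allI)
      fix j show "count (m - {#i#}) j \<le> 1 \<longleftrightarrow> count m j \<le> 1"
        using n 0 by (cases "j = i") auto
    qed
    then show ?thesis using n 0 by (simp add: sgn_wt_def coeff_E)
  next
    case (Suc n')
    \<comment> \<open>The exponent of \<open>i\<close> in \<open>m\<close> is \<open>Suc n\<close>,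
      so at least two copies of \<open>i\<close> remain.\<close>
    have z: "coeff E (m - replicate_mset k i) = 0" if "k < n" for k
    proof -
      have "\<not> count (m - replicate_mset k i) i \<le> 1" using that n by simp
      then show ?thesis unfolding coeff_E by metis
    qed
    have e: "coeff E (m - replicate_mset n i) = coeff E (m - replicate_mset (Suc n) i)"
    proof -
      have "(\<forall>j. count (m - replicate_mset n i) j \<le> 1) \<longleftrightarrow> (\<forall>j. count (m - replicate_mset (Suc n) i) j \<le> 1)"
      proof (intro iff_allI)
        fix j show "count (m - replicate_mset n i) j \<le> 1 \<longleftrightarrow> count (m - replicate_mset (Suc n) i) j \<le> 1"
          using n by (cases "j = i") auto
      qed
      then show ?thesis by (simp only: coeff_E)
    qed
    have "(\<Sum>k=1..count m i. sgn_wt k * coeff E (m - replicate_mset k i)) =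
        (\<Sum>k\<in>{n, Suc n}. sgn_wt k * coeff E (m - replicate_mset k i))"
      using n Suc by (intro sum.mono_neutral_right) (auto simp: z)
    also have "\<dots> = 0" using e by (simp add: sgn_wt_def)
    also have "0 = coeff E m"
    proof -
      have "\<not> count m i \<le> 1" using n Suc by simp
      then show ?thesis unfolding coeff_E by metis
    qed
    finally show ?thesis .
  qed
qed

text \<open>Each variable contributes the coefficient of \<open>m\<close> itself; if that is
  nonzero, all exponents are 1 and the number of variables is the degree.\<close>

lemma euler_E:
  assumes V: "((\<lambda>k. const (sgn_wt k) * p_sym k) has_sum V) {1..}"
  shows "euler E = E * V"
proof (rule series_eqI)
  fix m
  have "coeff (E * V) m = (\<Sum>i\<in>set_mset m. coeff E m)"
    unfolding coeff_mult_power_sum[OF V] by (rule sum.cong[OF refl sum_sgn_wt_E])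
  also have "\<dots> = of_nat (size m) * coeff E m"
  proof (cases "\<forall>i. count m i \<le> 1")
    case True
    have "(\<Sum>i\<in>set_mset m. count m i) = (\<Sum>i\<in>set_mset m. 1)"
    proof (rule sum.cong)
      fix i assume "i \<in># m"
      then have "count m i \<noteq> 0" by (simp add: count_eq_zero_iff)
      then show "count m i = 1" using True[rule_format, of i] by linarith
    qed simp
    then show ?thesis by (simp add: size_conv_sum_count)
  next
    case False
    then have "coeff E m = 0" by (simp only: coeff_E if_False)
    then show ?thesis by simp
  qed
  finally show "coeff (euler E) m = coeff (E * V) m" by simp
qed

subsection \<open>Moebius inversion\<close>

text \<open>Expand the product of -1 + 1 over \<open>A\<close>.\<close>

lemma sum_alternating_card_Pow:
  assumes "finite A" "A \<noteq> {}"
  shows "(\<Sum>X\<in>Pow A. (- 1 :: int) ^ card X) = 0"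
  using prod_add[OF assms(1), of "\<lambda>_. - 1 :: int" "\<lambda>_. 1"] assms by (simp add: power_0_left card_eq_0_iff)

text \<open>The squarefree divisors of \<open>n\<close> correspond to the sets of prime factors of
  \<open>n\<close>, and the signs cancel unless there are no prime factors.\<close>

lemma sum_mobius_divisors:
  assumes "n > 0"
  shows "(\<Sum>d | d dvd n. mobius d) = (if n = 1 then 1 else 0)"
proof -
  have fin: "finite {d. d dvd n}" using assms by (rule finite_divisors_nat)
  have sub: "P \<subseteq> prime_factors n \<Longrightarrow> p \<in> P \<Longrightarrow> prime p" for P p by auto
  have pf: "prime_factors (\<Prod>P) = P" if "P \<subseteq> prime_factors n" for P
  proof -
    have "finite P" using that by (rule finite_subset) simp
    moreover have "0 \<notin> (\<lambda>p. p) ` P" using sub[OF that, of 0] by auto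
    ultimately have "prime_factors (\<Prod>P) = \<Union>((prime_factors \<circ> (\<lambda>p. p)) ` P)"
      by (rule prime_factors_prod)
    also have "\<dots> = (\<Union>p\<in>P. {p})"
      using sub[OF that] by (simp add: prime_factorization_prime)
    finally show ?thesis by simp
  qed
  have "(\<Sum>d | d dvd n. mobius d) = (\<Sum>d | d dvd n \<and> squarefree d. (- 1) ^ card (prime_factors d))"
    by (rule sum.mono_neutral_cong_right) (use fin in \<open>auto simp: mobius_def\<close>)
  also have "\<dots> = (\<Sum>P\<in>Pow (prime_factors n). (- 1) ^ card P)"
  proof (rule sum.reindex_bij_witness[where i = "\<lambda>P. \<Prod>P" and j = prime_factors])
    fix d assume d: "d \<in> {d. d dvd n \<and> squarefree d}"
    then have "d \<noteq> 0" using assms by auto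
    have "(\<Prod>p\<in>prime_factors d. p ^ multiplicity p d) = d"
      using prod_prime_factors[OF \<open>d \<noteq> 0\<close>] by simp
    moreover have "multiplicity p d = 1" if "p \<in> prime_factors d" for p
      using d that squarefree_factorial_semiring'[OF \<open>d \<noteq> 0\<close>] by auto
    ultimately show "\<Prod>(prime_factors d) = d" by simp
    show "prime_factors d \<in> Pow (prime_factors n)"
      using d assms dvd_prime_factors[of n d] by auto
  next
    fix P assume "P \<in> Pow (prime_factors n)"
    then have P: "P \<subseteq> prime_factors n" by simp
    then show "prime_factors (\<Prod>P) = P" by (rule pf)
    have "squarefree (\<Prod>P)"
      by (rule squarefree_prod_coprime) (auto intro: primes_coprime squarefree_prime sub[OF P])
    moreover have "\<Prod>P dvd (\<Prod>p\<in>prime_factors n. p ^ multiplicity p n)"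
    proof (rule prod_dvd_prod_subset2)
      fix p assume "p \<in> P"
      then have "p \<in> prime_factors n" using P by auto
      then show "p dvd p ^ multiplicity p n"
        by (simp add: prime_factors_multiplicity dvd_power)
    qed (use P in auto)
    then have "\<Prod>P dvd n" using prod_prime_factors[of n] assms by simp
    ultimately show "\<Prod>P \<in> {d. d dvd n \<and> squarefree d}" by simp
  qed simp
  also have "\<dots> = (if n = 1 then 1 else 0)"
  proof (cases "n = 1")
    case False
    then have "prime_factors n \<noteq> {}" using assms by (auto simp: prime_factorization_empty_iff)
    then show ?thesis using False by (simp add: sum_alternating_card_Pow)
  qed simp
  finally show ?thesis .
qed

text \<open>Regroups a double sum by the product \<open>n = a * b\<close>; the pair becomes a
  divisor of \<open>n\<close> and its cofactor.\<close>

lemma has_sum_divisors: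
  fixes f :: "nat \<Rightarrow> nat \<Rightarrow> series"
  assumes "((\<lambda>(a, b). f a b) has_sum s) ({1..} \<times> {1..})"
  shows "((\<lambda>n. \<Sum>d | d dvd n. f d (n div d)) has_sum s) {1..}"
proof (rule has_sum_series_Sigma)
  show "((\<lambda>(n, d). f d (n div d)) has_sum s) (SIGMA n:{1..}. {d. d dvd n})"
    using assms
    by (subst has_sum_reindex_bij_witness[where T = "{1..} \<times> {1..}" and h = "\<lambda>(a, b). f a b" and
          j = "\<lambda>(n, d). (d, n div d)" and i = "\<lambda>(a, b). (a * b, a)" and s' = s])
      (auto simp: Suc_le_eq div_greater_zero_iff dvd_imp_le intro: dvd_pos_nat)
  show "((\<lambda>d. case (n, d) of (n, d) \<Rightarrow> f d (n div d)) has_sum (\<Sum>d | d dvd n. f d (n div d))) {d. d dvd n}"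
    if "n \<in> {1..}" for n
    using that by (auto intro!: has_sum_finiteI finite_divisors_nat)
qed

lemma has_sum_mult_order_exists:
  assumes "\<And>a b. a > 0 \<Longrightarrow> b > 0 \<Longrightarrow> order_ge (a * b) (f a b)"
  obtains s where "((\<lambda>(a :: nat, b :: nat). f a b) has_sum s) ({1..} \<times> {1..})"
proof (rule has_sum_series_exists[of "{1..} \<times> {1..}" "\<lambda>(a, b). a * b" "\<lambda>(a, b). f a b"])
  fix n :: nat
  show "finite {x \<in> {1..} \<times> {1..}. (case x of (a, b) \<Rightarrow> a * b) \<le> n}"
  proof (rule finite_subset)
    show "{x \<in> {1..} \<times> {1..}. (case x of (a, b) \<Rightarrow> a * b) \<le> n} \<subseteq> {..n} \<times> {..n}"
    proof
      fix x assume x: "x \<in> {x \<in> {1..} \<times> {1..}. (case x of (a, b) \<Rightarrow> a * b) \<le> n}"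
      obtain a b where ab: "x = (a, b)" by force
      have "1 \<le> a" "1 \<le> b" "a * b \<le> n" using x ab by auto
      moreover have "a * 1 \<le> a * b" "1 * b \<le> a * b" by (intro mult_le_mono calculation order_refl)+
      ultimately have "a \<le> n" "b \<le> n" by linarith+
      then show "x \<in> {..n} \<times> {..n}" using ab by simp
    qed
  qed simp
qed (use assms that in auto)

subsection \<open>The product of geometric series\<close>

abbreviation p1 :: series where "p1 \<equiv> p_sym (Suc 0)"

definition geom :: series where "geom = (\<Sum>\<^sub>\<infinity>j. p1 ^ j)"

text \<open>As \<open>geom\<close> is 1 / (1 - p_1), this is p_1 / (1 - p_1), which is also the
  logarithmic derivative of \<open>geom\<close>.\<close>

definition geom_pos :: series where "geom_pos = p1 * geom"

lemma order_ge_p1_power: "order_ge j (p1 ^ j)"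
  using order_ge_power[OF order_ge_p_sym[of "Suc 0"], of j] by simp

lemma has_sum_geom: "((\<lambda>j. p1 ^ j) has_sum geom) UNIV"
proof -
  obtain s where "((\<lambda>j. p1 ^ j) has_sum s) UNIV"
    by (rule has_sum_series_exists[of UNIV "\<lambda>j. j" "\<lambda>j. p1 ^ j"]) (simp_all add: order_ge_p1_power)
  then show ?thesis unfolding geom_def by (simp add: infsumI)
qed

lemma has_sum_geom_pos: "((\<lambda>j. p1 ^ j) has_sum geom_pos) {1..}"
proof -
  have "((\<lambda>j. p1 ^ Suc j) has_sum geom_pos) UNIV"
    unfolding geom_pos_def power_Suc by (rule has_sum_series_cmult[OF has_sum_geom])
  moreover have "bij_betw Suc UNIV {1..}"
    by (rule bij_betw_byWitness[where f' = "\<lambda>n. n - 1"]) auto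
  ultimately show ?thesis
    using has_sum_reindex_bij_betw[of Suc UNIV "{1..}" "\<lambda>j. p1 ^ j" geom_pos] by simp
qed

lemma geom_eq: "geom = 1 + geom_pos"
proof -
  have "((\<lambda>j. p1 ^ j) has_sum (p1 ^ 0 + geom_pos)) (insert 0 {1..})"
    by (rule has_sum_insert[OF _ has_sum_geom_pos]) simp
  moreover have "insert 0 {1..} = (UNIV :: nat set)" by auto
  ultimately show ?thesis using has_sum_unique[OF has_sum_geom] by simp
qed

lemma order_ge_geom_pos: "order_ge 1 geom_pos"
  by (rule order_ge_has_sum[OF has_sum_geom_pos]) (auto intro: order_ge_mono[OF order_ge_p1_power])

lemma one_minus_p1_mult_geom: "(1 - p1) * geom = 1"
proof -
  have "(1 - p1) * geom = geom - geom_pos" by (simp add: geom_pos_def left_diff_distrib)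
  then show ?thesis by (simp add: geom_eq)
qed

text \<open>Differentiate \<open>geom = 1 + p1 * geom\<close>, solve for \<open>euler geom\<close>,
  and use that \<open>geom\<close> inverts \<open>1 - p1\<close>.\<close>

lemma euler_geom: "euler geom = geom * geom_pos"
proof -
  have "euler geom = euler (1 + p1 * geom)" using geom_eq by (simp add: geom_pos_def)
  also have "\<dots> = geom_pos + p1 * euler geom" by (simp add: euler_add euler_mult euler_p_sym geom_pos_def)
  finally have "(1 - p1) * euler geom = geom_pos" unfolding left_diff_distrib mult_1 diff_eq_eq .
  then have "geom * geom_pos = ((1 - p1) * geom) * euler geom" by (simp add: mult_ac)
  then show ?thesis by (simp add: one_minus_p1_mult_geom)
qed

text \<open>Apply the ring homomorphism p_n to \<open>(1 - p1) * geom = 1\<close>.\<close>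

lemma inverse_one_minus_p_sym:
  assumes "n > 0" shows "inverse (1 - p_sym n) = p_plethysm n geom"
proof (rule inverse_series_eqI)
  have "p_plethysm n (1 + const (-1) * p1) = 1 + const (-1) * p_sym n"
    using assms by (simp add: p_plethysm_add p_plethysm_const_mult p_plethysm_p_sym)
  then have "p_plethysm n (1 - p1) = 1 - p_sym n"
    by (simp add: const_minus)
  then have "(1 - p_sym n) * p_plethysm n geom = p_plethysm n ((1 - p1) * geom)"
    using assms by (simp add: p_plethysm_mult)
  then show "(1 - p_sym n) * p_plethysm n geom = 1"
    using assms by (simp add: one_minus_p1_mult_geom)
qed

lemma coeff_mult_empty: "coeff (f * g) {#} = coeff f {#} * coeff g {#}"
  by (simp add: coeff_mult)

lemma prod_p_plethysm_geom:
  assumes "finite A" "0 \<notin> A"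
  shows "euler (\<Prod>n\<in>A. p_plethysm n geom) =
      (\<Prod>n\<in>A. p_plethysm n geom) * (\<Sum>n\<in>A. const (of_nat n) * p_plethysm n geom_pos)" (is ?ode)
    and "coeff (\<Prod>n\<in>A. p_plethysm n geom) {#} = 1" (is ?const)
proof -
  have "?ode \<and> ?const" using assms
  proof (induction A rule: finite_induct)
    case (insert n A)
    then have n: "n > 0" by auto
    have "coeff geom_pos {#} = 0" using order_ge_geom_pos by (auto simp: order_ge_def)
    then have "coeff (p_plethysm n geom) {#} = 1"
      using coeff_p_plethysm_repeat[OF n, of geom "{#}"] by (simp add: geom_eq coeff_1)
    moreover have "euler (p_plethysm n geom) = p_plethysm n geom * (const (of_nat n) * p_plethysm n geom_pos)"
      using n by (simp add: euler_p_plethysm euler_geom p_plethysm_mult mult_ac)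
    ultimately show ?case using insert
      by (simp add: euler_mult coeff_mult_empty algebra_simps)
  qed (simp add: coeff_1)
  then show ?ode ?const by auto
qed

text \<open>Factors with \<open>n\<close> above the degree of \<open>m\<close> do not affect the
  logarithmic derivative up to that degree. So partial products containing all smaller
  \<open>n\<close> agree with \<open>X\<close> at \<open>m\<close> by
  \<open>euler_eq_unique\<close>.\<close>

lemma has_infprod_inverse_one_minus_p_sym:
  assumes T: "0 \<notin> T"
    and W: "((\<lambda>n. const (of_nat n) * p_plethysm n geom_pos) has_sum W) T"
    and X: "euler X = X * W" "coeff X {#} = 1"
  shows "has_infprod (\<lambda>n. inverse (1 - p_sym n)) T X"
  unfolding has_infprod_def tendsto_series_iff eventually_finite_subsets_at_top
proof
  have ord: "order_ge n (const (of_nat n) * p_plethysm n geom_pos)" if "n \<in> T" for n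
    using that T by (intro order_ge_mult_right order_ge_p_plethysm1 order_ge_geom_pos) (auto intro: gr0I)
  have ord1: "order_ge 1 (const (of_nat n) * p_plethysm n geom_pos)" if "n \<in> T" for n
    using that T by (intro order_ge_mono[OF ord]) (auto simp: Suc_le_eq intro: gr0I)
  fix m
  show "\<exists>X\<^sub>0. finite X\<^sub>0 \<and> X\<^sub>0 \<subseteq> T \<and> (\<forall>Y. finite Y \<and> X\<^sub>0 \<subseteq> Y \<and> Y \<subseteq> T \<longrightarrow>
      coeff (\<Prod>n\<in>Y. inverse (1 - p_sym n)) m = coeff X m)"
  proof (intro exI[of _ "{n \<in> T. n \<le> size m}"] conjI allI impI)
    fix Y
    assume Y: "finite Y \<and> {n \<in> T. n \<le> size m} \<subseteq> Y \<and> Y \<subseteq> T"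
    then have Y0: "0 \<notin> Y" and fin: "finite Y" using T by auto
    let ?P = "\<Prod>n\<in>Y. p_plethysm n geom"
    have "(\<Prod>n\<in>Y. inverse (1 - p_sym n)) = ?P"
      by (rule prod.cong) (use Y0 in \<open>auto intro!: inverse_one_minus_p_sym intro: gr0I\<close>)
    moreover have "coeff ?P m = coeff X m"
    proof (rule euler_eq_unique[OF prod_p_plethysm_geom(1)[OF fin Y0] X(1), where N = "size m"])
      show "order_ge 1 (\<Sum>n\<in>Y. const (of_nat n) * p_plethysm n geom_pos)"
        by (intro order_ge_sum ord1) (use Y in auto)
      show "order_ge 1 W"
        by (rule order_ge_has_sum[OF W ord1])
      show "coeff ?P {#} = coeff X {#}"
        by (simp add: prod_p_plethysm_geom(2)[OF fin Y0] X(2))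
    next
      fix m' :: "nat multiset" assume m': "size m' \<le> size m"
      have "coeff W m' = (\<Sum>n\<in>Y. coeff (const (of_nat n) * p_plethysm n geom_pos) m')"
      proof (rule has_sum_series_coeff[OF W fin])
        fix n assume n: "n \<in> T" "coeff (const (of_nat n) * p_plethysm n geom_pos) m' \<noteq> 0"
        then have "n \<le> size m'" using order_geD[OF ord] by blast
        then show "n \<in> Y" using n(1) m' Y by auto
      qed (use Y in auto)
      then show "coeff (\<Sum>n\<in>Y. const (of_nat n) * p_plethysm n geom_pos) m' = coeff W m'"
        by (simp add: coeff_sum)
    qed simp
    ultimately show "coeff (\<Prod>n\<in>Y. inverse (1 - p_sym n)) m = coeff X m" by simp
  qed auto
qed

section \<open>The sum of all p_k[h]\<close>

text \<open>This is \<open>\<Sum>\<^sub>k p\<^sub>k[h]\<close> when \<open>h\<close> has zero constant term; the coefficientwise definition makes it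
  additive for all \<open>h\<close>.\<close>

definition p_plethysm_total :: "series \<Rightarrow> series" where
  "p_plethysm_total h = Series (\<lambda>m. \<Sum>k=1..size m. coeff (p_plethysm k h) m)"

text \<open>As p_k[h] has order at least \<open>k\<close>, cutting the sum off at
  \<open>size m\<close> loses nothing.\<close>

lemma p_plethysm_total_has_sum:
  assumes "order_ge 1 h"
  shows "((\<lambda>k. p_plethysm k h) has_sum p_plethysm_total h) {1..}"
proof (rule has_sum_seriesI[where C = "\<lambda>m. {1..size m}"])
  fix m k assume "k \<in> {1..}" "coeff (p_plethysm k h) m \<noteq> 0"
  then show "k \<in> {1..size m}"
    using order_geD[OF order_ge_p_plethysm1[OF _ assms], of k m] by auto
qed (auto simp: p_plethysm_total_def)

lemma local_map_p_plethysm_total: "local_map p_plethysm_total"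
  unfolding local_map_def
proof (intro conjI allI)
  fix f g show "p_plethysm_total (f + g) = p_plethysm_total f + p_plethysm_total g"
    by (rule series_eqI) (simp add: p_plethysm_total_def p_plethysm_add flip: sum.distrib)
next
  fix m :: "nat multiset"
  show "\<exists>M. finite M \<and> (\<forall>f g. (\<forall>k\<in>M. coeff f k = coeff g k) \<longrightarrow>
      coeff (p_plethysm_total f) m = coeff (p_plethysm_total g) m)"
  proof (intro exI[of _ "\<Union>k\<in>{1..size m}. {m'. repeat_mset k m' = m}"] conjI allI impI)
    fix f g assume fg: "\<forall>k\<in>\<Union>k\<in>{1..size m}. {m'. repeat_mset k m' = m}. coeff f k = coeff g k"
    show "coeff (p_plethysm_total f) m = coeff (p_plethysm_total g) m"
      unfolding p_plethysm_total_def coeff_Series p_plethysm_def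
      by (intro sum.cong refl) (use fg in auto)
  qed (auto intro: finite_repeat_mset_eq)
qed

lemmas p_plethysm_total_local = local_map_has_sum[OF local_map_p_plethysm_total]

lemma p_plethysm_total_add:
  "p_plethysm_total (f + g) = p_plethysm_total f + p_plethysm_total g"
  using local_map_p_plethysm_total unfolding local_map_def by blast

lemma p_plethysm_total_const_mult:
  "p_plethysm_total (const c * f) = const c * p_plethysm_total f"
  by (rule series_eqI) (simp add: p_plethysm_total_def p_plethysm_const_mult sum_distrib_left)

text \<open>The operations p_k and p_n commute, both composites being p_{nk}.\<close>

lemma p_plethysm_total_p_plethysm:
  assumes "n > 0" "order_ge 1 h"
  shows "p_plethysm_total (p_plethysm n h) = p_plethysm n (p_plethysm_total h)"
proof (rule has_sum_unique)
  show "((\<lambda>k. p_plethysm k (p_plethysm n h)) has_sum p_plethysm_total (p_plethysm n h)) {1..}"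
    using assms by (intro p_plethysm_total_has_sum order_ge_mono[OF order_ge_p_plethysm1]) auto
  show "((\<lambda>k. p_plethysm k (p_plethysm n h)) has_sum p_plethysm n (p_plethysm_total h)) {1..}"
    using p_plethysm_has_sum[OF assms(1) p_plethysm_total_has_sum[OF assms(2)]]
    by (rule has_sum_cong[THEN iffD1, rotated])
      (use assms in \<open>auto simp: p_plethysm_p_plethysm mult.commute\<close>)
qed

text \<open>The sign is 1 for odd \<open>k\<close> and 1 - 2 for even \<open>k\<close>, and the
  terms with even index satisfy p_{2k}[h] = p_2[p_k[h]].\<close>

lemma p_plethysm_alternating_has_sum:
  assumes "order_ge 1 h"
  shows "((\<lambda>k. const (sgn_wt k) * p_plethysm k h) has_sum
     (p_plethysm_total h + const (-2) * p_plethysm 2 (p_plethysm_total h))) {1..}"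
proof -
  note h = p_plethysm_total_has_sum[OF assms]
  let ?f = "\<lambda>k. if even k then const (-2) * p_plethysm k h else 0"
  have "((\<lambda>k. const (-2) * p_plethysm 2 (p_plethysm k h)) has_sum
     const (-2) * p_plethysm 2 (p_plethysm_total h)) {1..}"
    by (intro has_sum_series_cmult p_plethysm_has_sum h) simp
  then have "((\<lambda>k. ?f (2 * k)) has_sum const (-2) * p_plethysm 2 (p_plethysm_total h)) {1..}"
    by (rule has_sum_cong[THEN iffD1, rotated]) (simp add: p_plethysm_p_plethysm)
  then have "(?f has_sum const (-2) * p_plethysm 2 (p_plethysm_total h)) ((\<lambda>k. 2 * k) ` {1..})"
    by (subst has_sum_reindex) (auto simp: inj_on_def o_def)
  then have "(?f has_sum const (-2) * p_plethysm 2 (p_plethysm_total h)) {1..}"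
    by (rule has_sum_cong_neutral[THEN iffD1, rotated -1]) (auto simp: image_iff elim!: evenE)
  from has_sum_add[OF h this] show ?thesis
  proof (rule has_sum_cong[THEN iffD1, rotated])
    fix k
    show "p_plethysm k h + ?f k = const (sgn_wt k) * p_plethysm k h"
      by (rule series_eqI) (simp add: sgn_wt_def)
  qed
qed

section \<open>The series Lie and its Euler derivative\<close>

lemma order_ge_p_sym_power: "order_ge (n * k) (p_sym n ^ k)"
  using order_ge_power[OF order_ge_p_sym] by (simp add: mult.commute)

lemma const_of_int_sum: "(\<Sum>x\<in>A. const (of_int (f x))) = const (of_int (\<Sum>x\<in>A. f x))"
  unfolding of_int_series[symmetric] by simp

text \<open>The summand of \<open>Lie_n (d * j)\<close> that belongs to the divisor
  \<open>d\<close>. Indexing by \<open>(d, j)\<close> makes \<open>Lie\<close> a double sum that can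
  be regrouped freely.\<close>

definition Lie_term :: "nat \<Rightarrow> nat \<Rightarrow> series" where
  "Lie_term d j = const (of_int (mobius d) / of_nat (d * j)) * p_sym d ^ j"

lemma order_ge_Lie_term: "order_ge (d * j) (Lie_term d j)"
  unfolding Lie_term_def by (intro order_ge_mult_right order_ge_p_sym_power)

lemma Lie_n_eq:
  assumes "n > 0" shows "Lie_n n = (\<Sum>d | d dvd n. Lie_term d (n div d))"
  unfolding Lie_n_def sum_distrib_left Lie_term_def
  by (rule sum.cong) (auto simp: of_int_series mult.assoc[symmetric] simp flip: const_mult)

lemma order_ge_Lie_n:
  assumes "n > 0" shows "order_ge n (Lie_n n)"
  unfolding Lie_n_eq[OF assms]
proof (rule order_ge_sum)
  fix d assume "d \<in> {d. d dvd n}"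
  then show "order_ge n (Lie_term d (n div d))" using order_ge_Lie_term[of d "n div d"] by simp
qed

text \<open>The double sum converges since its terms have order at least \<open>d * j\<close>.
  Grouping by this product gives the \<open>Lie_n\<close>, so the \<open>infsum\<close> defining
  \<open>Lie\<close> is a genuine sum.\<close>

lemma has_sum_Lie_term: "((\<lambda>(d, j). Lie_term d j) has_sum Lie) ({1..} \<times> {1..})"
  and has_sum_Lie_n: "(Lie_n has_sum Lie) {1..}"
proof -
  obtain s where s: "((\<lambda>(d, j). Lie_term d j) has_sum s) ({1..} \<times> {1..})"
    by (rule has_sum_mult_order_exists[OF order_ge_Lie_term])
  have "(Lie_n has_sum s) {1..}"
    using has_sum_divisors[OF s] by (rule has_sum_cong[THEN iffD1, rotated]) (simp add: Lie_n_eq)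
  then show "(Lie_n has_sum Lie) {1..}" "((\<lambda>(d, j). Lie_term d j) has_sum Lie) ({1..} \<times> {1..})"
    using s infsumI unfolding Lie_def by metis+
qed

lemma order_ge_Lie: "order_ge 1 Lie"
  by (rule order_ge_has_sum[OF has_sum_Lie_n]) (auto intro: order_ge_mono[OF order_ge_Lie_n])

lemma euler_Lie_term:
  assumes "d > 0" "j > 0"
  shows "euler (Lie_term d j) = const (of_int (mobius d)) * p_sym d ^ j"
  using assms unfolding Lie_term_def euler_const_mult euler_power_eigen[OF euler_p_sym]
  by (simp add: mult.assoc[symmetric] flip: const_mult)

lemma p_plethysm_p1_power: "d > 0 \<Longrightarrow> p_plethysm d (p1 ^ j) = p_sym d ^ j"
  by (simp add: p_plethysm_power p_plethysm_p_sym)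

text \<open>The derivation cancels the denominators \<open>d * j\<close>, which leaves a geometric
  series in p_d for each \<open>d\<close>.\<close>

lemma has_sum_euler_Lie: "((\<lambda>d. const (of_int (mobius d)) * p_plethysm d geom_pos) has_sum euler Lie) {1..}"
proof (rule has_sum_series_Sigma)
  show "((\<lambda>(d, j). euler (Lie_term d j)) has_sum euler Lie) (SIGMA d:{1..}. {1..})"
    using euler_has_sum[OF has_sum_Lie_term] by (simp add: case_prod_unfold)
  fix d :: nat assume d: "d \<in> {1..}"
  then have "((\<lambda>j. const (of_int (mobius d)) * p_plethysm d (p1 ^ j)) has_sum
      const (of_int (mobius d)) * p_plethysm d geom_pos) {1..}"
    by (intro has_sum_series_cmult p_plethysm_has_sum has_sum_geom_pos) auto
  then show "((\<lambda>j. case (d, j) of (d, j) \<Rightarrow> euler (Lie_term d j)) has_sum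
      const (of_int (mobius d)) * p_plethysm d geom_pos) {1..}"
    by (rule has_sum_cong[THEN iffD1, rotated]) (use d in \<open>simp add: euler_Lie_term p_plethysm_p1_power\<close>)
qed

text \<open>Moebius inversion: the double sum of mu(d) p_{dk}[\<open>geom_pos\<close>] is grouped by
  \<open>n = d * k\<close>, and only \<open>n = 1\<close> survives.\<close>

lemma p_plethysm_total_euler_Lie: "p_plethysm_total (euler Lie) = geom_pos"
proof -
  define f where "f d k = const (of_int (mobius d)) * p_plethysm (d * k) geom_pos" for d k
  obtain s where s: "((\<lambda>(d, k). f d k) has_sum s) ({1..} \<times> {1..})"
    by (rule has_sum_mult_order_exists[of f])
      (auto simp: f_def intro!: order_ge_mult_right order_ge_p_plethysm1 order_ge_geom_pos)
  have "((\<lambda>d. p_plethysm_total (const (of_int (mobius d)) * p_plethysm d geom_pos)) has_sum s) {1..}"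
  proof (rule has_sum_series_Sigma[OF s])
    fix d :: nat assume d: "d \<in> {1..}"
    then have "((\<lambda>k. const (of_int (mobius d)) * p_plethysm d (p_plethysm k geom_pos)) has_sum
        const (of_int (mobius d)) * p_plethysm d (p_plethysm_total geom_pos)) {1..}"
      by (intro has_sum_series_cmult p_plethysm_has_sum p_plethysm_total_has_sum order_ge_geom_pos) auto
    then have "((\<lambda>k. f d k) has_sum
        const (of_int (mobius d)) * p_plethysm d (p_plethysm_total geom_pos)) {1..}"
      by (rule has_sum_cong[THEN iffD1, rotated]) (use d in \<open>simp add: f_def p_plethysm_p_plethysm\<close>)
    then show "((\<lambda>k. case (d, k) of (d, k) \<Rightarrow> f d k) has_sum
        p_plethysm_total (const (of_int (mobius d)) * p_plethysm d geom_pos)) {1..}"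
      using d order_ge_geom_pos by (simp add: p_plethysm_total_const_mult p_plethysm_total_p_plethysm)
  qed
  then have 1: "p_plethysm_total (euler Lie) = s"
    by (rule has_sum_unique[OF p_plethysm_total_local[OF has_sum_euler_Lie]])
  have "((\<lambda>n. if n = 1 then geom_pos else 0) has_sum s) {1 :: nat..}"
    using has_sum_divisors[OF s]
  proof (rule has_sum_cong[THEN iffD1, rotated])
    fix n :: nat assume n: "n \<in> {1..}"
    have "(\<Sum>d | d dvd n. f d (n div d)) = (\<Sum>d | d dvd n. const (of_int (mobius d))) * p_plethysm n geom_pos"
      unfolding sum_distrib_right by (rule sum.cong) (auto simp: f_def)
    also have "\<dots> = (if n = 1 then geom_pos else 0)"
      using n by (simp add: const_of_int_sum sum_mobius_divisors)
    finally show "(\<Sum>d | d dvd n. f d (n div d)) = (if n = 1 then geom_pos else 0)" .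
  qed
  moreover have "((\<lambda>n. if n = 1 then geom_pos else 0) has_sum geom_pos) {1 :: nat..}"
    by (rule has_sum_finite_neutralI[of "{1}"]) auto
  ultimately have "s = geom_pos" by (rule has_sum_unique)
  then show ?thesis using 1 by simp
qed

section \<open>Plethysms of Lie and of sums of power sums\<close>

lemma plethysm_p_sym_Lie_term:
  assumes "d > 0" "m > 0"
  shows "const (of_int (mobius d) / of_nat (d * j)) * p_plethysm d (p_sym m) ^ j = p_plethysm m (Lie_term d j)"
  unfolding Lie_term_def using assms
  by (simp add: p_plethysm_const_mult p_plethysm_power p_plethysm_p_sym mult.commute[of d m])

text \<open>The expansion of \<open>Lie\<close> uses the partitions with \<open>j\<close> equal
  parts \<open>d\<close>. As p_d[p_m] = p_m[p_d], substituting p_m termwise is the same as applying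
  p_m to \<open>Lie\<close>.\<close>

lemma plethysm_Lie_p_sym:
  assumes "m > 0" shows "Lie\<lbrakk>p_sym m\<rbrakk> = p_plethysm m Lie"
proof (rule plethysm_eqI_inj[where A = "{1..} \<times> {1..}" and l = "\<lambda>(d, j). replicate_mset j d"
      and a = "\<lambda>(d, j). of_int (mobius d) / of_nat (d * j)"])
  \<comment> \<open>Starting \<open>j\<close> at 1 matters: \<open>j = 0\<close> would give the
    empty partition for every \<open>d\<close>.\<close>
  show "inj_on (\<lambda>(d, j). replicate_mset j d) ({1..} \<times> {1 :: nat..})"
    by (auto simp: inj_on_def replicate_mset_eq_iff)
  show "(\<lambda>(d, j). replicate_mset j d) ` ({1..} \<times> {1..}) \<subseteq> partitions"
    by (auto simp: partitions_def)
  show "((\<lambda>x. const (case x of (d, j) \<Rightarrow> of_int (mobius d) / of_nat (d * j)) *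
      p_prod (case x of (d, j) \<Rightarrow> replicate_mset j d)) has_sum Lie) ({1..} \<times> {1..})"
    using has_sum_Lie_term by (simp add: case_prod_unfold Lie_term_def)
  show "((\<lambda>x. const (case x of (d, j) \<Rightarrow> of_int (mobius d) / of_nat (d * j)) *
      p_prod_plethysm (case x of (d, j) \<Rightarrow> replicate_mset j d) (p_sym m)) has_sum p_plethysm m Lie)
      ({1..} \<times> {1..})"
    using p_plethysm_has_sum[OF assms has_sum_Lie_term]
    by (rule has_sum_cong[THEN iffD1, rotated])
      (use assms plethysm_p_sym_Lie_term in auto)
qed

lemma plethysm_Lie_n_p_sym:
  assumes "n > 0" "m > 0" shows "(Lie_n n)\<lbrakk>p_sym m\<rbrakk> = p_plethysm m (Lie_n n)"
proof (rule plethysm_eqI_inj[where A = "{d. d dvd n}" and l = "\<lambda>d. replicate_mset (n div d) d"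
      and a = "\<lambda>d. of_int (mobius d) / of_nat (d * (n div d))"])
  have pos: "d > 0" "n div d > 0" if "d dvd n" for d
    using that assms(1) by (auto simp: div_greater_zero_iff dvd_imp_le intro: dvd_pos_nat)
  show "inj_on (\<lambda>d. replicate_mset (n div d) d) {d. d dvd n}"
    by (rule inj_onI) (use pos in \<open>auto simp: replicate_mset_eq_iff\<close>)
  show "(\<lambda>d. replicate_mset (n div d) d) ` {d. d dvd n} \<subseteq> partitions"
    using pos by (auto simp: partitions_def split: if_splits)
  show "((\<lambda>d. const (of_int (mobius d) / of_nat (d * (n div d))) * p_prod (replicate_mset (n div d) d))
      has_sum Lie_n n) {d. d dvd n}"
    using assms by (intro has_sum_finiteI) (auto simp: finite_divisors_nat Lie_n_eq Lie_term_def)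
  have "p_plethysm m (Lie_n n) =
     (\<Sum>d | d dvd n. const (of_int (mobius d) / of_nat (d * (n div d))) * p_plethysm d (p_sym m) ^ (n div d))"
    unfolding Lie_n_eq[OF assms(1)] p_plethysm_sum[OF assms(2)]
    by (rule sum.cong) (use assms pos in \<open>auto simp only: plethysm_p_sym_Lie_term mem_Collect_eq\<close>)
  then show "((\<lambda>d. const (of_int (mobius d) / of_nat (d * (n div d))) *
      p_prod_plethysm (replicate_mset (n div d) d) (p_sym m)) has_sum p_plethysm m (Lie_n n)) {d. d dvd n}"
    using assms by (intro has_sum_finiteI) (simp_all add: finite_divisors_nat)
qed

lemma has_sum_p_set: "0 \<notin> T \<Longrightarrow> (p_sym has_sum p_set T) T"
proof -
  obtain s where "(p_sym has_sum s) T"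
    by (rule has_sum_series_exists[of T "\<lambda>n. n" p_sym]) (simp_all add: order_ge_p_sym)
  then show ?thesis unfolding p_set_def by (simp add: infsumI)
qed

lemma plethysm_p_set:
  assumes "0 \<notin> T" "((\<lambda>m. p_plethysm m g) has_sum s) T"
  shows "(p_set T)\<lbrakk>g\<rbrakk> = s"
proof (rule plethysm_eqI_inj[where A = T and l = "\<lambda>n. {#n#}" and a = "\<lambda>_. 1"])
  show "((\<lambda>x. const 1 * p_prod {#x#}) has_sum p_set T) T"
    using has_sum_p_set[OF assms(1)] by simp
qed (use assms in \<open>auto simp: partitions_def inj_on_def intro: gr0I\<close>)

section \<open>The series F and its logarithmic derivative\<close>

text \<open>Chains m | d | n are reindexed by \<open>m\<close> and \<open>e = d div m\<close>. The
  summand then is p_m applied to the term of \<open>Lie_n (n div m)\<close> for the divisor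
  \<open>e\<close>.\<close>

lemma f_n_eq:
  assumes "n > 0"
  shows "f_n T n = (\<Sum>m | m \<in> T \<and> m dvd n. p_plethysm m (Lie_n (n div m)))"
proof -
  have pos: "d > 0" if "d dvd n" for d using that assms by (auto intro: dvd_pos_nat)
  have fin: "finite {d. d dvd k}" if "k dvd n" for k using pos[OF that] by (rule finite_divisors_nat)
  let ?A = "SIGMA d:{d. d dvd n}. {m. m dvd d \<and> m \<in> T}"
  let ?B = "SIGMA m:{m. m \<in> T \<and> m dvd n}. {e. e dvd n div m}"
  have "f_n T n = (\<Sum>d | d dvd n. \<Sum>m | m dvd d \<and> m \<in> T.
      const (of_nat m * of_int (mobius (d div m)) / of_nat n) * p_sym d ^ (n div d))"
    unfolding f_n_def sum_distrib_left
  proof (rule sum.cong)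
    fix d
    have "const (1 / of_nat n) * (of_int (psi T d) * p_sym d ^ (n div d)) =
        const (of_int (psi T d) / of_nat n) * p_sym d ^ (n div d)"
      by (simp add: of_int_series mult.assoc[symmetric] flip: const_mult)
    also have "of_int (psi T d) / of_nat n =
        (\<Sum>m | m dvd d \<and> m \<in> T. of_nat m * of_int (mobius (d div m)) / (of_nat n :: rat))"
      by (simp add: psi_def sum_divide_distrib)
    also have "const \<dots> * p_sym d ^ (n div d) = (\<Sum>m | m dvd d \<and> m \<in> T.
        const (of_nat m * of_int (mobius (d div m)) / of_nat n) * p_sym d ^ (n div d))"
      by (rule series_eqI) (simp add: coeff_sum sum_distrib_right)
    finally show "const (1 / of_nat n) * (of_int (psi T d) * p_sym d ^ (n div d)) = \<dots>" .
  qed simp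
  also have "\<dots> = (\<Sum>(d, m)\<in>?A. const (of_nat m * of_int (mobius (d div m)) / of_nat n) * p_sym d ^ (n div d))"
    using fin assms by (intro sum.Sigma) (auto intro: finite_subset[OF _ fin])
  also have "\<dots> = (\<Sum>(m, e)\<in>?B. p_plethysm m (Lie_term e (n div m div e)))"
  proof (rule sum.reindex_bij_witness[where i = "\<lambda>(m, e). (m * e, m)" and j = "\<lambda>(d, m). (m, d div m)"])
    fix x assume "x \<in> ?A"
    then obtain d m where x: "x = (d, m)" "d dvd n" "m dvd d" "m \<in> T" by auto
    obtain e where e: "d = m * e" using x by blast
    obtain c where c: "n = d * c" using x by blast
    have p: "m > 0" "e > 0" "c > 0" using assms by (auto simp: c e intro: gr0I)
    show "(case (case x of (d, m) \<Rightarrow> (m, d div m)) of (m, e) \<Rightarrow> (m * e, m)) = x"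
      using x by simp
    show "(case x of (d, m) \<Rightarrow> (m, d div m)) \<in> ?B"
      using p x by (simp add: c e mult.assoc)
    have d: "n div d = c" "n div m div e = c" "d div m = e" using p by (simp_all add: c e mult.assoc)
    \<comment> \<open>The weight \<open>m\<close> in \<open>psi\<close> turns the denominator
      \<open>n = m * e * c\<close> into \<open>n div m\<close>, the one in
      \<open>Lie_n (n div m)\<close>.\<close>
    have "of_int (mobius e) / of_nat (e * c) = (of_nat m * of_int (mobius e) / of_nat n :: rat)"
      using p by (simp add: c e)
    then show "(case case x of (d, m) \<Rightarrow> (m, d div m) of (m, e) \<Rightarrow> p_plethysm m (Lie_term e (n div m div e))) =
        (case x of (d, m) \<Rightarrow> const (of_nat m * of_int (mobius (d div m)) / of_nat n) * p_sym d ^ (n div d))"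
      using p by (simp add: x d d(1)[unfolded e] Lie_term_def p_plethysm_const_mult p_plethysm_power
          p_plethysm_p_sym e del: of_nat_mult)
  next
    fix y assume "y \<in> ?B"
    then obtain m e where y: "y = (m, e)" "m \<in> T" "m dvd n" "e dvd n div m" by auto
    have "m > 0" using y pos by blast
    then show "(case (case y of (m, e) \<Rightarrow> (m * e, m)) of (d, m) \<Rightarrow> (m, d div m)) = y"
      using y by simp
    obtain k where k: "n = m * k" using y by blast
    show "(case y of (m, e) \<Rightarrow> (m * e, m)) \<in> ?A"
      using y \<open>m > 0\<close> by (simp add: k)
  qed
  also have "\<dots> = (\<Sum>m | m \<in> T \<and> m dvd n. \<Sum>e | e dvd n div m. p_plethysm m (Lie_term e (n div m div e)))"
    by (intro sum.Sigma[symmetric] ballI fin) (auto intro: finite_subset[OF _ fin[of n]])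
  also have "\<dots> = (\<Sum>m | m \<in> T \<and> m dvd n. p_plethysm m (Lie_n (n div m)))"
  proof (rule sum.cong)
    fix m assume m: "m \<in> {m. m \<in> T \<and> m dvd n}"
    then have "m > 0" "n div m > 0" using assms pos by (auto simp: div_greater_zero_iff dvd_imp_le)
    then show "(\<Sum>e | e dvd n div m. p_plethysm m (Lie_term e (n div m div e))) = p_plethysm m (Lie_n (n div m))"
      by (simp add: Lie_n_eq p_plethysm_sum)
  qed simp
  finally show ?thesis .
qed

text \<open>One double sum of p_m[\<open>Lie_n n\<close>], read in two ways: grouping by
  \<open>m * n\<close> gives the \<open>f_n T\<close>, summing over \<open>n\<close> first gives
  p_m[\<open>Lie\<close>].\<close>

lemma has_sum_F:
  assumes "0 \<notin> T"
  shows "((\<lambda>m. p_plethysm m Lie) has_sum F T) T"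
proof -
  \<comment> \<open>Extended by 0 outside \<open>T\<close>, so that the regrouping over all pairs of
    positive integers applies.\<close>
  define f where "f m n = (if m \<in> T then p_plethysm m (Lie_n n) else 0)" for m n
  obtain s where s: "((\<lambda>(m, n). f m n) has_sum s) ({1..} \<times> {1..})"
    by (rule has_sum_mult_order_exists[of f]) (auto simp: f_def intro!: order_ge_p_plethysm order_ge_Lie_n)
  have "(f_n T has_sum s) {1..}"
    using has_sum_divisors[OF s]
  proof (rule has_sum_cong[THEN iffD1, rotated])
    fix n :: nat assume n: "n \<in> {1..}"
    then have "finite {d. d dvd n}" by (intro finite_divisors_nat) auto
    then show "(\<Sum>d | d dvd n. f d (n div d)) = f_n T n"
      using n by (subst f_n_eq) (auto simp: f_def intro!: sum.mono_neutral_cong_right split: if_splits)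
  qed
  then have F: "F T = s" unfolding F_def by (rule infsumI)
  have "((\<lambda>m. if m \<in> T then p_plethysm m Lie else 0) has_sum s) {1..}"
  proof (rule has_sum_series_Sigma[OF s])
    fix m :: nat assume "m \<in> {1..}"
    then show "((\<lambda>n. case (m, n) of (m, n) \<Rightarrow> f m n) has_sum (if m \<in> T then p_plethysm m Lie else 0)) {1..}"
      unfolding f_def prod.case using p_plethysm_has_sum[OF _ has_sum_Lie_n, of m] by auto
  qed
  then have "((\<lambda>m. p_plethysm m Lie) has_sum s) T"
    by (rule has_sum_cong_neutral[THEN iffD1, rotated -1]) (use assms in \<open>auto simp: Suc_le_eq intro: gr0I\<close>)
  then show ?thesis unfolding F .
qed

lemma order_ge_F:
  assumes "0 \<notin> T" shows "order_ge 1 (F T)"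
  by (rule order_ge_has_sum[OF has_sum_F[OF assms]])
     (use assms in \<open>auto simp: Suc_le_eq intro!: order_ge_mono[OF order_ge_p_plethysm1[OF _ order_ge_Lie]] intro: gr0I\<close>)

text \<open>Both operators pass through the sum for \<open>F T\<close>; \<open>euler\<close>
  contributes the factor \<open>m\<close>, and p_m moves outside
  \<open>p_plethysm_total\<close>.\<close>

lemma has_sum_p_plethysm_total_euler_F:
  assumes "0 \<notin> T"
  shows "((\<lambda>m. const (of_nat m) * p_plethysm m geom_pos) has_sum p_plethysm_total (euler (F T))) T"
  using p_plethysm_total_local[OF euler_has_sum[OF has_sum_F[OF assms]]]
proof (rule has_sum_cong[THEN iffD1, rotated])
  fix m assume "m \<in> T"
  then have "m > 0" using assms by (auto intro: gr0I)
  then show "p_plethysm_total (euler (p_plethysm m Lie)) = const (of_nat m) * p_plethysm m geom_pos"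
    by (simp add: euler_p_plethysm p_plethysm_total_const_mult p_plethysm_total_p_plethysm
        order_ge_euler[OF order_ge_Lie, unfolded One_nat_def] p_plethysm_total_euler_Lie)
qed

section \<open>The series G and its relation to F\<close>

text \<open>As Lie[p_{m 2^k}] = p_{2^k}[p_m[Lie]], the inner sum over \<open>m\<close> is p_{2^k}
  applied to \<open>F T\<close>.\<close>

lemma has_sum_G:
  assumes "0 \<notin> T"
  shows "((\<lambda>k. p_plethysm (2 ^ k) (F T)) has_sum G T) UNIV"
proof -
  have "(\<Sum>\<^sub>\<infinity>m\<in>T. Lie\<lbrakk>p_sym (m * 2 ^ k)\<rbrakk>) = p_plethysm (2 ^ k) (F T)" for k
  proof (rule infsumI)
    show "((\<lambda>m. Lie\<lbrakk>p_sym (m * 2 ^ k)\<rbrakk>) has_sum p_plethysm (2 ^ k) (F T)) T"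
      using p_plethysm_has_sum[OF _ has_sum_F[OF assms], of "2 ^ k", OF zero_less_power[OF zero_less_numeral]]
    proof (rule has_sum_cong[THEN iffD1, rotated])
      fix m assume "m \<in> T"
      then have "m > 0" using assms by (auto intro: gr0I)
      then show "p_plethysm (2 ^ k) (p_plethysm m Lie) = Lie\<lbrakk>p_sym (m * 2 ^ k)\<rbrakk>"
        by (simp add: plethysm_Lie_p_sym p_plethysm_p_plethysm mult.commute)
    qed
  qed
  then have G: "G T = (\<Sum>\<^sub>\<infinity>k. p_plethysm (2 ^ k) (F T))" by (simp add: G_def)
  \<comment> \<open>The term for \<open>k\<close> has order at least 2^k, hence at least
    \<open>k\<close>.\<close>
  obtain s where "((\<lambda>k. p_plethysm (2 ^ k) (F T)) has_sum s) UNIV"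
  proof (rule has_sum_series_exists[of UNIV "\<lambda>k. k" "\<lambda>k. p_plethysm (2 ^ k) (F T)"])
    show "order_ge k (p_plethysm (2 ^ k) (F T))" for k
      by (rule order_ge_mono[OF order_ge_p_plethysm1]) (simp_all add: order_ge_F[OF assms, simplified] less_imp_le)
  qed simp_all
  then show ?thesis unfolding G by (simp add: infsumI)
qed

lemma order_ge_G:
  assumes "0 \<notin> T" shows "order_ge 1 (G T)"
  by (rule order_ge_has_sum[OF has_sum_G[OF assms]])
     (auto intro!: order_ge_mono[OF order_ge_p_plethysm1[OF _ order_ge_F[OF assms]]])

text \<open>Split off \<open>k = 0\<close>; applying p_2 shifts \<open>k\<close> by one.\<close>

lemma G_eq:
  assumes "0 \<notin> T" shows "G T = F T + p_plethysm 2 (G T)"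
proof (rule has_sum_unique[OF has_sum_G[OF assms]])
  have "((\<lambda>k. p_plethysm 2 (p_plethysm (2 ^ k) (F T))) has_sum p_plethysm 2 (G T)) UNIV"
    by (rule p_plethysm_has_sum[OF _ has_sum_G[OF assms]]) simp
  then have "((\<lambda>k. p_plethysm (2 ^ Suc k) (F T)) has_sum p_plethysm 2 (G T)) UNIV"
    by (simp add: p_plethysm_p_plethysm)
  moreover have "bij_betw Suc UNIV {1..}"
    by (rule bij_betw_byWitness[where f' = "\<lambda>n. n - 1"]) auto
  ultimately have "((\<lambda>k. p_plethysm (2 ^ k) (F T)) has_sum p_plethysm 2 (G T)) {1..}"
    using has_sum_reindex_bij_betw[of Suc UNIV "{1..}" "\<lambda>k. p_plethysm (2 ^ k) (F T)"] by blast
  then have "((\<lambda>k. p_plethysm (2 ^ k) (F T)) has_sum (p_plethysm (2 ^ 0) (F T) + p_plethysm 2 (G T))) (insert 0 {1..})"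
    by (rule has_sum_insert[rotated]) simp
  moreover have "insert 0 {1..} = (UNIV :: nat set)" by auto
  ultimately show "((\<lambda>k. p_plethysm (2 ^ k) (F T)) has_sum (F T + p_plethysm 2 (G T))) UNIV"
    by simp
qed

text \<open>In \<open>G_eq\<close>, \<open>euler\<close> turns p_2[G] into 2 p_2[D G], and p_2
  commutes with \<open>p_plethysm_total\<close>. The extra term is exactly the one that the signs of
  \<open>E\<close> subtract.\<close>

lemma p_plethysm_total_euler_G:
  assumes "0 \<notin> T"
  shows "p_plethysm_total (euler (G T)) + const (-2) * p_plethysm 2 (p_plethysm_total (euler (G T))) =
    p_plethysm_total (euler (F T))"
proof -
  have "euler (G T) = euler (F T) + const 2 * p_plethysm 2 (euler (G T))"
    using G_eq[OF assms] by (metis euler_add euler_p_plethysm of_nat_numeral zero_less_numeral)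
  then have "p_plethysm_total (euler (G T)) =
      p_plethysm_total (euler (F T)) + const 2 * p_plethysm 2 (p_plethysm_total (euler (G T)))"
    using order_ge_euler[OF order_ge_G[OF assms]]
    by (metis p_plethysm_total_add p_plethysm_total_const_mult p_plethysm_total_p_plethysm zero_less_numeral)
  then show ?thesis by (metis const_minus add_diff_cancel_right' mult_minus_left add_uminus_conv_diff)
qed

section \<open>Differential equations for H[g] and E[g], and the conclusion\<close>

lemma H_plethysm_ode:
  assumes "order_ge 1 g"
  shows "euler (H\<lbrakk>g\<rbrakk>) = H\<lbrakk>g\<rbrakk> * p_plethysm_total (euler g)" "coeff (H\<lbrakk>g\<rbrakk>) {#} = 1"
proof -
  have P: "((\<lambda>k. const 1 * p_sym k) has_sum p_set {1..}) {1..}"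
    using has_sum_p_set[of "{1..}"] by simp
  have "((\<lambda>k. const 1 * p_plethysm k (euler g)) has_sum p_plethysm_total (euler g)) {1..}"
    using p_plethysm_total_has_sum[OF order_ge_euler[OF assms]] by simp
  note * = plethysm_ode[OF P euler_H[OF P] coeff_H assms this]
  show "euler (H\<lbrakk>g\<rbrakk>) = H\<lbrakk>g\<rbrakk> * p_plethysm_total (euler g)" "coeff (H\<lbrakk>g\<rbrakk>) {#} = 1" by (rule *)+
qed

lemma E_plethysm_ode:
  assumes "order_ge 1 g"
  shows "euler (E\<lbrakk>g\<rbrakk>) =
      E\<lbrakk>g\<rbrakk> * (p_plethysm_total (euler g) + const (-2) * p_plethysm 2 (p_plethysm_total (euler g)))"
    and "coeff (E\<lbrakk>g\<rbrakk>) {#} = 1"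
proof -
  obtain V0 where P: "((\<lambda>k. const (sgn_wt k) * p_sym k) has_sum V0) {1..}"
    by (rule has_sum_series_exists[of "{1..}" "\<lambda>k. k" "\<lambda>k. const (sgn_wt k) * p_sym k"])
      (auto intro: order_ge_mult_right order_ge_p_sym)
  have "coeff E {#} = 1" by (simp add: coeff_E)
  note * = plethysm_ode[OF P euler_E[OF P] this assms p_plethysm_alternating_has_sum[OF order_ge_euler[OF assms]]]
  show "euler (E\<lbrakk>g\<rbrakk>) =
      E\<lbrakk>g\<rbrakk> * (p_plethysm_total (euler g) + const (-2) * p_plethysm 2 (p_plethysm_total (euler g)))"
    and "coeff (E\<lbrakk>g\<rbrakk>) {#} = 1" by (rule *)+
qed

theorem theorem5p4:
  fixes T :: "nat set"
  assumes "T \<noteq> {}" and "0 \<notin> T"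
  shows
    "has_infprod (\<lambda>n. inverse (1 - p_sym n)) T (H\<lbrakk>F T\<rbrakk>) \<and>
     (F T = (p_set T)\<lbrakk>Lie\<rbrakk> \<and>
      ((\<lambda>m. Lie\<lbrakk>p_sym m\<rbrakk>) has_sum F T) T \<and>
      (\<forall>n\<ge>1. f_n T n = (\<Sum>m | m \<in> T \<and> m dvd n. (Lie_n (n div m))\<lbrakk>p_sym m\<rbrakk>))) \<and>
     (has_infprod (\<lambda>n. inverse (1 - p_sym n)) T (E\<lbrakk>G T\<rbrakk>) \<and>
      E\<lbrakk>G T\<rbrakk> = H\<lbrakk>F T\<rbrakk>)"
proof -
  note W = has_sum_p_plethysm_total_euler_F[OF assms(2)]
  note odeH = H_plethysm_ode[OF order_ge_F[OF assms(2)]]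
  \<comment> \<open>The unfolding gives \<open>odeE\<close> the same logarithmic derivative as
    \<open>odeH\<close>, so the same \<open>W\<close> serves for both products.\<close>
  note odeE = E_plethysm_ode[OF order_ge_G[OF assms(2)], unfolded p_plethysm_total_euler_G[OF assms(2)]]
  have pos: "m > 0" if "m \<in> T" for m using that assms(2) by (auto intro: gr0I)
  have prodH: "has_infprod (\<lambda>n. inverse (1 - p_sym n)) T (H\<lbrakk>F T\<rbrakk>)"
    by (rule has_infprod_inverse_one_minus_p_sym[OF assms(2) W odeH])
  have prodE: "has_infprod (\<lambda>n. inverse (1 - p_sym n)) T (E\<lbrakk>G T\<rbrakk>)"
    by (rule has_infprod_inverse_one_minus_p_sym[OF assms(2) W odeE])
  \<comment> \<open>Both are limits of the same partial products, and the topology is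
    Hausdorff.\<close>
  then have "E\<lbrakk>G T\<rbrakk> = H\<lbrakk>F T\<rbrakk>"
    using prodH unfolding has_infprod_def
    by (rule tendsto_unique[OF finite_subsets_at_top_neq_bot])
  moreover have "((\<lambda>m. Lie\<lbrakk>p_sym m\<rbrakk>) has_sum F T) T"
    using has_sum_F[OF assms(2)]
    by (rule has_sum_cong[THEN iffD1, rotated]) (simp add: plethysm_Lie_p_sym pos)
  moreover have "F T = (p_set T)\<lbrakk>Lie\<rbrakk>"
    by (rule plethysm_p_set[OF assms(2) has_sum_F[OF assms(2)], symmetric])
  moreover have "f_n T n = (\<Sum>m | m \<in> T \<and> m dvd n. (Lie_n (n div m))\<lbrakk>p_sym m\<rbrakk>)" if "n \<ge> 1" for n
  proof -
    have "n > 0" using that by simp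
    then show ?thesis
      unfolding f_n_eq[OF \<open>n > 0\<close>]
      by (intro sum.cong) (auto simp: plethysm_Lie_n_p_sym pos div_greater_zero_iff dvd_imp_le)
  qed
  ultimately show ?thesis using prodH prodE by blast
qed

end
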